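(* Let $c_1,c_2\ge 0$ and consider the ODE problem $$w_t=f_1(z)g_1(w),\quad z_t=f_2(z)g_2(w),\quad t>0,\qquad w(0)=c_1,\quad z(0)=c_2. \qquad (\ast)$$ Assume that, for $i=1,2$, $f_i(z)\ge 0$ and $f_i'(z)\ge 0$ for $z\ge 0$, with $f_i\not\equiv 0$ and $f_i'\not\equiv 0$ in any subinterval of $(0,+\infty)$, and $g_i(w)\ge 0$ and $g_i'(w)\ge 0$ for $w\ge 0$, with $g_i\not\equiv 0$ and $g_i'\not\equiv 0$ in any subinterval of $(0,+\infty)$. (1) If $\int_{c_1}^{+\infty}\frac{dw}{g_1(w)}<+\infty$ or $\int_{c_2}^{+\infty}\frac{dz}{f_2(z)}<+\infty$, then the solution of $(\ast)$ blows up in finite time for positive initial data. (2) Assume that $\int_{c_1}^{+\infty}\frac{dw}{g_1(w)}=+\infty$ and $\int_{c_2}^{+\infty}\frac{dz}{f_2(z)}=+\infty$. Let $\tilde f,\tilde g,\tilde c_1,\tilde c_2$ and the transformed problem $$W_t=\tilde f(Z),\quad Z_t=\tilde g(W),\quad t>0,\qquad W(0)=\tilde c_1\ge 0,\quad Z(0)=\tilde c_2\ge 0 \qquad (\ast\ast)$$ be as defined in the context. Suppose there exist $0\le\tilde c_3\le\tilde c_1$ and $0\le\tilde c_4\le\tilde c_2$ such that $\tilde f(Z)\ge 0$, $\tilde f'(Z)\ge 0$ for all $Z\ge\tilde c_4$ and $\tilde g(W)\ge 0$, $\tilde g'(W)\ge 0$ for all $W\ge\tilde c_3$. Let $$\tilde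 F(Z)=\int_{\tilde c_4}^{Z}\tilde f(s)\,ds,\qquad \tilde G(W)=\int_{\tilde c_3}^{W}\tilde g(\theta)\,d\theta ,$$ and suppose there exist positive constants $\epsilon$ and $K$ such that $$\epsilon\,\tilde G(\tilde c_1)\le\tilde F(\tilde c_2)\le K\,\tilde G(\tilde c_1).$$ Let $\tilde F^{-1},\tilde G^{-1}$ be the inverse functions of $\tilde F,\tilde G$. Then the solution of $(\ast\ast)$ exists globally if $$\int_{\tilde c_1}^{+\infty}\frac{ds}{\tilde f[\tilde F^{-1}(K\tilde G(s))]}=+\infty\quad\text{and}\quad\int_{\tilde c_2}^{+\infty}\frac{d\theta}{\tilde g[\tilde G^{-1}(\frac1\epsilon\tilde F(\theta))]}=+\infty,$$ and it blows up in finite time for large initial data if $$\int_{\tilde c_1}^{+\infty}\frac{ds}{\tilde f[\tilde F^{-1}(\epsilon\tilde G(s))]}<+\infty\quad\text{or}\quad\int_{\tilde c_2}^{+\infty}\frac{d\theta}{\tilde g[\tilde G^{-1}(\frac1K\tilde F(\theta))]}<+\infty.$$ Consequently, the solution of $(\ast)$ exists globally, respectively blows up in finite time, in the corresponding case.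
   Context: The functions $f_i$ and $g_i$ are smooth. "Exists globally" means the solution exists for all $t>0$; "blows up in finite time" means that the solution becomes unbounded as $t\to T^-$ for some finite $T>0$. Transformed problem in part (2): put $$G_1(w)=\int_{c_1}^{w}\frac{ds}{g_1(s)},\qquad F_2(z)=\int_{c_2}^{z}\frac{d\theta}{f_2(\theta)},$$ $W(t)=G_1(w(t))$, $Z(t)=F_2(z(t))$, $\tilde f(Z)=f_1[F_2^{-1}(Z)]$, $\tilde g(W)=g_2[G_1^{-1}(W)]$. With these, problem $(\ast)$ becomes $(\ast\ast)$, and $\tilde c_1=W(0)$, $\tilde c_2=Z(0)$ denote its initial data. *)

theory Defs
  imports "HOL-Analysis.Analysis"
begin

(* All nonlinearities live on [0,\<infinity>): derivatives at 0 are one-sided and values at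
   negative arguments are irrelevant. *)

definition smooth_halfline :: "(real \<Rightarrow> real) \<Rightarrow> bool" where
  "smooth_halfline h \<longleftrightarrow>
     (\<exists>D :: nat \<Rightarrow> real \<Rightarrow> real. D 0 = h \<and>
        (\<forall>n. \<forall>x\<ge>0. (D n has_real_derivative D (Suc n) x) (at x within {0..})))"

definition admissible :: "(real \<Rightarrow> real) \<Rightarrow> bool" where
  "admissible h \<longleftrightarrow>
     smooth_halfline h \<and>
     (\<forall>x\<ge>0. 0 \<le> h x \<and> 0 \<le> vector_derivative h (at x within {0..})) \<and>
     (\<forall>a b. 0 \<le> a \<and> a < b \<longrightarrow>
        (\<exists>x\<in>{a<..<b}. h x \<noteq> 0) \<and>
        (\<exists>x\<in>{a<..<b}. vector_derivative h (at x within {0..}) \<noteq> 0))"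

(* The system w' = P w z, z' = Q w z for t > 0 with w 0 = a, z 0 = b, on a time interval J
   starting at 0.  The phase space is the closed first quadrant. *)
definition solves_on ::
  "real set \<Rightarrow> (real \<Rightarrow> real \<Rightarrow> real) \<Rightarrow> (real \<Rightarrow> real \<Rightarrow> real) \<Rightarrow> real \<Rightarrow> real \<Rightarrow>
   (real \<Rightarrow> real) \<Rightarrow> (real \<Rightarrow> real) \<Rightarrow> bool" where
  "solves_on J P Q a b w z \<longleftrightarrow>
     w 0 = a \<and> z 0 = b \<and> continuous_on J w \<and> continuous_on J z \<and>
     (\<forall>t\<in>J. 0 \<le> w t \<and> 0 \<le> z t) \<and>
     (\<forall>t\<in>J. 0 < t \<longrightarrow>
        (w has_real_derivative P (w t) (z t)) (at t) \<and>
        (z has_real_derivative Q (w t) (z t)) (at t))"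

(* For the systems considered here the right-hand sides are smooth, so solutions are unique and
   existence of a global (resp. blowing-up) solution is a statement about the solution. *)
definition exists_globally ::
  "(real \<Rightarrow> real \<Rightarrow> real) \<Rightarrow> (real \<Rightarrow> real \<Rightarrow> real) \<Rightarrow> real \<Rightarrow> real \<Rightarrow> bool" where
  "exists_globally P Q a b \<longleftrightarrow> (\<exists>w z. solves_on {0..} P Q a b w z)"

definition blows_up ::
  "(real \<Rightarrow> real \<Rightarrow> real) \<Rightarrow> (real \<Rightarrow> real \<Rightarrow> real) \<Rightarrow> real \<Rightarrow> real \<Rightarrow> bool" where
  "blows_up P Q a b \<longleftrightarrow>
     (\<exists>T>0. \<exists>w z. solves_on {0..<T} P Q a b w z \<and>
        filterlim (\<lambda>t. norm (w t, z t)) at_top (at_left T))"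

(* The integral of 1/h over [a,\<infinity>) as an extended value, for h \<ge> 0.  The division is the one
   of ennreal, where 1/0 = \<infinity>. *)
definition recip_integral :: "real \<Rightarrow> (real \<Rightarrow> real) \<Rightarrow> ennreal" where
  "recip_integral a h = (\<integral>\<^sup>+ s\<in>{a..}. 1 / ennreal (h s) \<partial>lborel)"

definition primitive :: "real \<Rightarrow> (real \<Rightarrow> real) \<Rightarrow> real \<Rightarrow> real" where
  "primitive a h x = integral {a..x} h"

(* Finiteness of the integral of 1/h over [a,x] for all x \<ge> a, i.e. the function
   x \<mapsto> (integral of 1/h over [a,x]) makes sense on [a,\<infinity>); it can only fail if h a = 0. *)
definition recip_primitive_exists :: "real \<Rightarrow> (real \<Rightarrow> real) \<Rightarrow> bool" where
  "recip_primitive_exists a h \<longleftrightarrow> (\<forall>x\<ge>a. (\<lambda>s. 1 / h s) integrable_on {a..x})"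

(* In the theorem the base points c1, c2 of the primitives G1, F2 of 1/g1, 1/f2 are kept apart
   from the initial data w0 \<ge> c1, z0 \<ge> c2 of the original system; the case w0 = c1, z0 = c2 is
   included, but it forces G1 w0 = F2 z0 = 0.  As w0, z0 vary, G1 w0 and F2 z0 run through all
   nonnegative initial data of the transformed system.  G1 and F2 are inverted on [c1,\<infinity>) and
   [c2,\<infinity>), where they are strictly increasing. *)

end

theory Submission
  imports Defs
begin

text \<open>
  Both systems have separable orbits. For \<open>w' = f1 z * g1 w\<close>, \<open>z' = f2 z * g2 w\<close> the identity
  \<open>(g2 w / g1 w) dw = (f1 z / f2 z) dz\<close> determines \<open>w\<close> as an increasing function of \<open>z\<close>, and the time
  needed to reach \<open>z\<close> is an explicit integral. The solution is obtained by inverting that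
  travel time (locale \<open>separable_system\<close>): it is global if the travel time is unbounded along the
  orbit, and otherwise it blows up, because an orbit leaves every bounded set.

  In part (1), \<open>g2 w\<close> is bounded below by its positive initial value, so the travel time is at most a
  multiple of the integral of \<open>1 / f2\<close>. The case of the integral of \<open>1 / g1\<close> follows by interchanging
  the equations.

  In part (2) the transformed system \<open>W' = f Z\<close>, \<open>Z' = g W\<close> conserves \<open>G W - F Z\<close>, where \<open>F\<close> and \<open>G\<close>
  are the primitives of \<open>f\<close> and \<open>g\<close>. Therefore the travel time is an integral of
  \<open>1 / g (G\<^sup>-\<^sup>1 (F Z + e))\<close> with a constant \<open>e\<close>, whereas the theorem speaks of integrals of
  \<open>1 / g (G\<^sup>-\<^sup>1 (\<kappa> * F Z))\<close>. By monotonicity of \<open>f\<close> and of \<open>g \<circ> G\<^sup>-\<^sup>1\<close>, rescaling \<open>F\<close> by an affine map shows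
  that these integrals converge or diverge together, whatever \<open>\<kappa> > 0\<close> and \<open>e\<close> are
  (\<open>bounded_by_rescaled_comparison\<close>). What remains is the start of the orbit. An integral could also diverge
  at its lower limit; the inequalities between \<open>F\<close> and \<open>G\<close> at the initial data make the two energies
  vanish simultaneously, which excludes this as soon as the variable that serves as parameter has
  positive initial speed. If neither variable has, the data are an equilibrium and the solution is
  constant. In the blow-up case, large data make both initial speeds positive.

  Solutions of the transformed system are carried back to the original one by the inverses of
  \<open>\<integral> ds / g1 s\<close> and \<open>\<integral> d\<theta> / f2 \<theta>\<close>, which map \<open>[0, \<infinity>)\<close> onto half-lines because the integrals diverge.
  These inverses are differentiable since the existence of the primitives forces \<open>g1 c1 > 0\<close> and
  \<open>f2 c2 > 0\<close> (\<open>recip_primitive_exists_imp_pos\<close>).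
\<close>

section \<open>Primitives and inverses of increasing functions\<close>

lemma primitive_at_base [simp]: "primitive a h a = 0"
  by (simp add: primitive_def)

text \<open>The intervals \<open>[a, b)\<close> and \<open>[a, \<infinity>)\<close> treated together: the solutions below live on an
  interval whose right end is not known beforehand.\<close>

definition half_open_from :: "real \<Rightarrow> real set \<Rightarrow> bool" where
  "half_open_from a S \<longleftrightarrow> a \<in> S \<and> S \<subseteq> {a..} \<and> (\<forall>x\<in>S. {a..x} \<subseteq> S \<and> (\<exists>y\<in>S. x < y))"

lemma half_open_from_atLeast [simp]: "half_open_from a {a..}"
proof -
  have "\<exists>y\<in>{a..}. x < y" if "a \<le> x" for x
    using that by (intro bexI[of _ "x + 1"]) auto
  then show ?thesis by (auto simp: half_open_from_def)
qed

lemma half_open_from_subset: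
  assumes "half_open_from a S" and "x \<in> S"
  shows "a \<le> x" and "{a..x} \<subseteq> S"
  using assms unfolding half_open_from_def by blast+

lemma half_open_from_beyond:
  assumes "half_open_from a S" and "x \<in> S"
  obtains y where "y \<in> S" and "x < y" and "{a..y} \<subseteq> S"
proof -
  obtain y where "y \<in> S" "x < y"
    using assms unfolding half_open_from_def by blast
  then show thesis
    using that half_open_from_subset(2)[OF assms(1)] by blast
qed

lemma half_open_from_is_interval: "half_open_from a S \<Longrightarrow> is_interval S"
  unfolding is_interval_1
proof (intro ballI allI impI)
  fix x y t assume S: "half_open_from a S" and "x \<in> S" "y \<in> S" "x \<le> t \<and> t \<le> y"
  then have "t \<in> {a..y}" using half_open_from_subset(1)[OF S, of x] by simp
  then show "t \<in> S" using half_open_from_subset(2)[OF S \<open>y \<in> S\<close>] by blast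
qed

lemma primitive_has_derivative_within:
  assumes S: "half_open_from a S" and h: "continuous_on S h" and x: "x \<in> S"
  shows "(primitive a h has_real_derivative h x) (at x within S)"
proof -
  obtain y where y: "y \<in> S" "x < y" "{a..y} \<subseteq> S"
    using half_open_from_beyond[OF S x] .
  have "((\<lambda>x. integral {a..x} h) has_real_derivative h x) (at x within {a..y})"
    using half_open_from_subset(1)[OF S x] y
    by (intro integral_has_real_derivative continuous_on_subset[OF h]) auto
  moreover have "at x within {a..y} = at x within S"
    using half_open_from_subset(1)[OF S] y
    by (intro at_within_nhd[of _ "{..<y}"]) auto
  ultimately show ?thesis
    by (simp add: primitive_def[abs_def])
qed

lemma half_open_from_interior:
  assumes S: "half_open_from a S" and x: "x \<in> S" "a < x"
  shows "x \<in> interior S"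
proof -
  obtain y where "y \<in> S" "x < y" "{a..y} \<subseteq> S"
    using half_open_from_beyond[OF S x(1)] .
  then show ?thesis
    using x by (intro interiorI[of "{a<..<y}"]) auto
qed

lemma primitive_has_derivative:
  assumes S: "half_open_from a S" and h: "continuous_on S h" and x: "x \<in> S" "a < x"
  shows "(primitive a h has_real_derivative h x) (at x)"
  using primitive_has_derivative_within[OF S h x(1)]
    at_within_interior[OF half_open_from_interior[OF S x]] by simp

lemma primitive_continuous:
  assumes "half_open_from a S" and "continuous_on S h"
  shows "continuous_on S (primitive a h)"
  using primitive_has_derivative_within[OF assms] by (rule DERIV_continuous_on)

lemma primitive_strict_mono:
  assumes S: "half_open_from a S" and h: "continuous_on S h"
    and pos: "\<And>x. x \<in> S \<Longrightarrow> a < x \<Longrightarrow> 0 < h x"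
  shows "strict_mono_on S (primitive a h)"
proof (rule strict_mono_onI)
  fix x y assume xy: "x \<in> S" "y \<in> S" "x < y"
  have "a \<le> x"
    using half_open_from_subset(1)[OF S xy(1)] .
  then have sub: "{x..y} \<subseteq> S"
    using half_open_from_subset(2)[OF S xy(2)] by auto
  show "primitive a h x < primitive a h y"
  proof (rule DERIV_pos_imp_increasing_open[OF xy(3)])
    show "\<exists>d. (primitive a h has_real_derivative d) (at t) \<and> 0 < d" if "x < t" "t < y" for t
    proof -
      have "t \<in> S" "a < t" using that sub \<open>a \<le> x\<close> by auto
      then show ?thesis using primitive_has_derivative[OF S h, of t] pos[of t] by blast
    qed
    show "continuous_on {x..y} (primitive a h)"
      by (rule continuous_on_subset[OF primitive_continuous[OF S h] sub])
  qed
qed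

lemma primitive_eqI:
  assumes h: "continuous_on {a..} h" and f: "continuous_on {a..} f"
    and der: "\<And>x. a < x \<Longrightarrow> (f has_real_derivative h x) (at x)" and "a \<le> x"
  shows "primitive a h x = f x - f a"
proof (cases "a = x")
  case False
  have "primitive a h x - f x = primitive a h a - f a"
  proof (rule DERIV_isconst_end[where f = "\<lambda>x. primitive a h x - f x"])
    show "a < x" using False assms(4) by simp
    show "continuous_on {a..x} (\<lambda>x. primitive a h x - f x)"
      by (intro continuous_on_diff continuous_on_subset[OF primitive_continuous[OF half_open_from_atLeast h]]
          continuous_on_subset[OF f]) auto
    show "((\<lambda>x. primitive a h x - f x) has_real_derivative 0) (at t)" if "a < t" for t
      using DERIV_diff[OF primitive_has_derivative[OF half_open_from_atLeast h _ that] der[OF that]] that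
      by simp
  qed
  then show ?thesis by simp
qed simp

lemma strict_mono_on_less_eq_iff:
  fixes f :: "real \<Rightarrow> real"
  assumes "strict_mono_on S f" "x \<in> S" "y \<in> S"
  shows "f x \<le> f y \<longleftrightarrow> x \<le> y" and "f x < f y \<longleftrightarrow> x < y"
  using assms by (metis less_le_not_le linorder_le_less_linear order_le_less strict_mono_onD)+

lemma inv_into_continuous:
  fixes f :: "real \<Rightarrow> real"
  assumes "half_open_from a S" "continuous_on S f" "strict_mono_on S f"
  shows "continuous_on (f ` S) (inv_into S f)"
proof -
  have inj: "inj_on f S"
    using assms(3) strict_mono_on_imp_inj_on by blast
  obtain g where g: "homeomorphism S (f ` S) f g"
    using homeomorphism_into_1d[OF _ assms(2) refl inj] half_open_from_is_interval[OF assms(1)]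
    by (meson is_interval_path_connected_1)
  have "continuous_on (f ` S) g"
    using g by (simp add: homeomorphism_def)
  then show ?thesis
    by (rule continuous_on_eq) (use g inj in \<open>auto simp: homeomorphism_def\<close>)
qed

text \<open>The derivative of the inverse is two-sided only at images of interior points of the interval; for
  this reason the solutions constructed below are required to leave their initial data at once.\<close>

lemma inv_into_has_derivative:
  fixes f :: "real \<Rightarrow> real"
  assumes int: "half_open_from a S" and cont: "continuous_on S f" and mono: "strict_mono_on S f"
    and x: "x \<in> S" "a < x" and der: "(f has_real_derivative D) (at x)" and "D \<noteq> 0"
  shows "(inv_into S f has_real_derivative 1 / D) (at (f x))"
proof -
  obtain e where e: "e > 0" "cball x e \<subseteq> S"
    using half_open_from_interior[OF int x] by (meson mem_interior_cball)
  have S: "x - e \<in> S" "x + e \<in> S" "{x - e..x + e} \<subseteq> S"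
    using e by (auto simp: cball_eq_atLeastAtMost dist_real_def)
  have img: "{f (x - e)<..<f (x + e)} \<subseteq> f ` S"
  proof
    fix y assume "y \<in> {f (x - e)<..<f (x + e)}"
    then have "\<exists>t\<ge>x - e. t \<le> x + e \<and> f t = y"
      using e(1) S continuous_on_subset[OF cont S(3)] by (intro IVT') auto
    with S(3) show "y \<in> f ` S" by auto
  qed
  have inj: "inj_on f S"
    using mono strict_mono_on_imp_inj_on by blast
  have inv: "inv_into S f (f x) = x"
    using inj x(1) by simp
  have mem: "f x \<in> {f (x - e)<..<f (x + e)}"
    using e(1) S x(1) strict_mono_onD[OF mono] by simp
  have "isCont (inv_into S f) (f x)"
    using continuous_on_subset[OF inv_into_continuous[OF int cont mono] img] mem
    by (simp add: continuous_on_eq_continuous_at)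
  moreover have "(f has_real_derivative D) (at (inv_into S f (f x)))"
    using der inv by simp
  ultimately have "(inv_into S f has_real_derivative inverse D) (at (f x))"
    using mem subsetD[OF img] \<open>D \<noteq> 0\<close>
    by (intro DERIV_inverse_function[where a = "f (x - e)" and b = "f (x + e)" and f = f])
      (auto simp: f_inv_into_f)
  then show ?thesis by (simp add: field_simps)
qed

lemma primitive_nonneg:
  assumes "continuous_on {p..} f" "\<And>x. p < x \<Longrightarrow> 0 < f x" and "p \<le> x"
  shows "0 \<le> primitive p f x"
  using strict_mono_on_less_eq_iff(1)[OF primitive_strict_mono[OF half_open_from_atLeast assms(1)], of p x]
    assms(2,3) by simp

lemma primitive_surjective:
  assumes h: "continuous_on {a..} h" "\<And>x. a < x \<Longrightarrow> 0 < h x"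
    and unbounded: "\<And>C. \<exists>x\<ge>a. C \<le> primitive a h x"
  shows "primitive a h ` {a..} = {0..}"
proof (intro equalityI subsetI)
  fix y assume "y \<in> primitive a h ` {a..}"
  then obtain x where x: "a \<le> x" "y = primitive a h x" by auto
  then show "y \<in> {0..}"
    using strict_mono_on_less_eq_iff(1)[OF primitive_strict_mono[OF half_open_from_atLeast h], of a x] by simp
next
  fix y :: real assume y: "y \<in> {0..}"
  obtain x where x: "a \<le> x" "y \<le> primitive a h x" using unbounded by blast
  have "\<exists>t\<ge>a. t \<le> x \<and> primitive a h t = y"
    using x y by (intro IVT' continuous_on_subset[OF primitive_continuous[OF half_open_from_atLeast h(1)]]) auto
  then show "y \<in> primitive a h ` {a..}" by auto
qed

text \<open>Beyond \<open>a + 1\<close> the integrand stays above \<open>h (a + 1) > 0\<close>, so the growth is at least linear.\<close>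

lemma monotone_primitive_unbounded:
  assumes h: "continuous_on {a..} h" "\<And>x. a < x \<Longrightarrow> 0 < h x" and mono: "mono_on {a..} h"
  shows "\<exists>x\<ge>a. C \<le> primitive a h x"
proof -
  define k where "k = h (a + 1)"
  have k: "k > 0" unfolding k_def using h(2) by simp
  define x where "x = a + 2 + max 0 (C / k)"
  have x: "a + 1 < x" by (simp add: x_def)
  obtain t where t: "a + 1 < t" "t < x"
      "primitive a h x - primitive a h (a + 1) = (x - (a + 1)) * h t"
    using MVT2[OF x, of "primitive a h" h] primitive_has_derivative[OF half_open_from_atLeast h(1)] by auto
  have "k \<le> h t"
    unfolding k_def using t by (intro mono_onD[OF mono]) auto
  have "C \<le> (x - (a + 1)) * k"
  proof -
    have "C / k \<le> x - (a + 1)" by (simp add: x_def)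
    then show ?thesis using k by (simp add: field_simps)
  qed
  also have "\<dots> \<le> (x - (a + 1)) * h t"
    using x \<open>k \<le> h t\<close> by (intro mult_left_mono) auto
  also have "\<dots> \<le> primitive a h x"
    using t(3) strict_mono_on_less_eq_iff(1)[OF primitive_strict_mono[OF half_open_from_atLeast h], of a "a + 1"] by simp
  finally show ?thesis using x by (intro exI[of _ x]) auto
qed

text \<open>This turns the hypotheses on improper integrals into boundedness of an antiderivative, which is
  the form in which travel times are compared.\<close>

lemma recip_integral_finite_iff:
  assumes h: "continuous_on {a..} h" "\<And>x. a \<le> x \<Longrightarrow> 0 < h x"
  shows "recip_integral a h < \<infinity> \<longleftrightarrow> (\<exists>C. \<forall>x\<ge>a. primitive a (\<lambda>s. 1 / h s) x \<le> C)"
proof -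
  define r where "r = (\<lambda>s. 1 / h s)"
  have r: "continuous_on {a..} r" "\<And>x. a \<le> x \<Longrightarrow> 0 < r x"
    unfolding r_def using h by (auto intro!: continuous_intros simp: less_imp_neq[THEN not_sym])
  have rr: "1 / ennreal (h s) = ennreal (r s)" if "a \<le> s" for s
    using h(2)[OF that] divide_ennreal[of 1 "h s"] by (simp add: r_def)
  have whole: "recip_integral a h = (\<integral>\<^sup>+ s. ennreal (r s) * indicator {a..} s \<partial>lborel)"
    unfolding recip_integral_def
    by (intro nn_integral_cong) (auto simp: rr split: split_indicator)
  have part: "(\<integral>\<^sup>+ s. ennreal (r s) * indicator {a..x} s \<partial>lborel) = ennreal (primitive a r x)" for x
    unfolding primitive_def
  proof (rule nn_integral_has_integral_lebesgue')
    show "0 \<le> r t" if "t \<in> {a..x}" for t using r(2)[of t] that by simp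
    show "(r has_integral integral {a..x} r) {a..x}"
      by (intro integrable_integral integrable_continuous_interval continuous_on_subset[OF r(1)]) auto
  qed
  have nonneg: "0 \<le> primitive a r x" if "a \<le> x" for x
    using strict_mono_on_less_eq_iff(1)[OF primitive_strict_mono[OF half_open_from_atLeast r(1)], of a x] r(2) that by simp
  show ?thesis unfolding r_def[symmetric]
  proof
    assume fin: "recip_integral a h < \<infinity>"
    show "\<exists>C. \<forall>x\<ge>a. primitive a r x \<le> C"
    proof (intro exI allI impI)
      fix x assume "a \<le> x"
      have "ennreal (primitive a r x) \<le> recip_integral a h"
        unfolding part[symmetric] whole by (intro nn_integral_mono) (auto split: split_indicator)
      then show "primitive a r x \<le> enn2real (recip_integral a h)"
        using fin by (metis enn2real_ennreal enn2real_mono infinity_ennreal_def nonneg \<open>a \<le> x\<close>)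
    qed
  next
    assume "\<exists>C. \<forall>x\<ge>a. primitive a r x \<le> C"
    then obtain C where C: "\<And>x. a \<le> x \<Longrightarrow> primitive a r x \<le> C" by blast
    have "(\<lambda>s. ennreal (r s) * indicator {a..} s) =
          (\<lambda>s. SUP n::nat. ennreal (r s) * indicator {a..a + real n} s)"
    proof
      fix s
      obtain n :: nat where n: "s - a \<le> real n" using real_arch_simple by blast
      show "ennreal (r s) * indicator {a..} s =
            (SUP n::nat. ennreal (r s) * indicator {a..a + real n} s)"
        by (rule antisym; (rule SUP_upper2[of n] | rule SUP_least))
          (use n in \<open>auto split: split_indicator\<close>)
    qed
    then have "recip_integral a h =
        (\<integral>\<^sup>+ s. (SUP n::nat. ennreal (r s) * indicator {a..a + real n} s) \<partial>lborel)"
      by (simp add: whole)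
    also have "\<dots> = (SUP n::nat. \<integral>\<^sup>+ s. ennreal (r s) * indicator {a..a + real n} s \<partial>lborel)"
    proof (rule nn_integral_monotone_convergence_SUP)
      show "incseq (\<lambda>(n::nat) s. ennreal (r s) * indicator {a..a + real n} s)"
        by (auto simp: incseq_def le_fun_def split: split_indicator)
      fix n :: nat
      have "continuous_on {a..a + real n} r"
        by (rule continuous_on_subset[OF r(1)]) auto
      then have "(\<lambda>s. indicator {a..a + real n} s *\<^sub>R r s) \<in> borel_measurable borel"
        by (rule borel_measurable_continuous_on_indicator[rotated]) auto
      then have "(\<lambda>s. ennreal (indicator {a..a + real n} s *\<^sub>R r s)) \<in> borel_measurable lborel"
        by simp
      also have "(\<lambda>s. ennreal (indicator {a..a + real n} s *\<^sub>R r s)) =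
          (\<lambda>s. ennreal (r s) * indicator {a..a + real n} s)"
        by (auto split: split_indicator)
      finally show "(\<lambda>s. ennreal (r s) * indicator {a..a + real n} s) \<in> borel_measurable lborel" .
    qed
    also have "\<dots> \<le> ennreal C"
      unfolding part by (intro SUP_least ennreal_leI C) simp
    finally show "recip_integral a h < \<infinity>"
      by (metis ennreal_less_top infinity_ennreal_def order_le_less_trans)
  qed
qed

section \<open>Separable systems\<close>

text \<open>Strictness keeps a solution in the region where changes of coordinates are differentiable from both
  sides.\<close>

definition strictly_solves_on ::
  "real set \<Rightarrow> (real \<Rightarrow> real \<Rightarrow> real) \<Rightarrow> (real \<Rightarrow> real \<Rightarrow> real) \<Rightarrow> real \<Rightarrow> real \<Rightarrow>
   (real \<Rightarrow> real) \<Rightarrow> (real \<Rightarrow> real) \<Rightarrow> bool" where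
  "strictly_solves_on J P Q a b w z \<longleftrightarrow>
     solves_on J P Q a b w z \<and> (\<forall>t\<in>J. 0 < t \<longrightarrow> a < w t \<and> b < z t)"

text \<open>Along an orbit of \<open>w' = f1 z * g1 w\<close>, \<open>z' = f2 z * g2 w\<close> the variables separate:
  \<open>(g2 w / g1 w) dw = (f1 z / f2 z) dz\<close>. Hence the potentials of the two sides agree, \<open>w\<close> is a
  function \<open>orbit\<close> of \<open>z\<close>, and the time at which \<open>z\<close> is reached is the integral of
  \<open>1 / (f2 z * g2 (orbit z))\<close>. Inverting this function of \<open>z\<close> produces the solution
  without an appeal to a general existence theorem for differential equations.

  The roles of \<open>w\<close> and \<open>z\<close> are not symmetric: \<open>z\<close> is the parameter, so its speed is positive
  from the start, while \<open>f1 z0 = 0\<close> is permitted.\<close>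

locale separable_system =
  fixes f1 f2 g1 g2 :: "real \<Rightarrow> real" and w0 z0 :: real
  assumes cont: "continuous_on {z0..} f1" "continuous_on {z0..} f2"
      "continuous_on {w0..} g1" "continuous_on {w0..} g2"
    and f1_pos: "z0 < z \<Longrightarrow> 0 < f1 z" and f2_pos: "z0 \<le> z \<Longrightarrow> 0 < f2 z"
    and g1_pos: "w0 \<le> w \<Longrightarrow> 0 < g1 w" and g2_pos: "w0 \<le> w \<Longrightarrow> 0 < g2 w"
    and data_nonneg: "0 \<le> w0" "0 \<le> z0"
begin

definition w_potential :: "real \<Rightarrow> real" where "w_potential = primitive w0 (\<lambda>w. g2 w / g1 w)"

definition z_potential :: "real \<Rightarrow> real" where "z_potential = primitive z0 (\<lambda>z. f1 z / f2 z)"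

text \<open>The values that \<open>z\<close> takes along the orbit. They stop short of infinity if the potential of \<open>w\<close> is
  bounded and is exhausted first.\<close>

definition swept :: "real set" where "swept = {z. z0 \<le> z \<and> z_potential z \<in> w_potential ` {w0..}}"

definition orbit :: "real \<Rightarrow> real" where "orbit z = inv_into {w0..} w_potential (z_potential z)"

definition speed :: "real \<Rightarrow> real" where "speed z = f2 z * g2 (orbit z)"

definition time :: "real \<Rightarrow> real" where "time = primitive z0 (\<lambda>z. 1 / speed z)"

lemma quotients_continuous:
  "continuous_on {w0..} (\<lambda>w. g2 w / g1 w)" "continuous_on {z0..} (\<lambda>z. f1 z / f2 z)"
  using g1_pos f2_pos
  by (auto intro!: continuous_intros cont simp: less_imp_neq[THEN not_sym])

lemma w_potential_props:
  shows w_potential_base: "w_potential w0 = 0"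
    and w_potential_continuous: "continuous_on {w0..} w_potential"
    and w_potential_strict_mono: "strict_mono_on {w0..} w_potential"
    and w_potential_derivative: "w0 < w \<Longrightarrow> (w_potential has_real_derivative g2 w / g1 w) (at w)"
  unfolding w_potential_def
  using primitive_continuous[OF half_open_from_atLeast quotients_continuous(1)]
    primitive_strict_mono[OF half_open_from_atLeast quotients_continuous(1)]
    primitive_has_derivative[OF half_open_from_atLeast quotients_continuous(1), of w] g1_pos g2_pos
  by auto

lemma z_potential_props:
  shows z_potential_base: "z_potential z0 = 0"
    and z_potential_continuous: "continuous_on {z0..} z_potential"
    and z_potential_strict_mono: "strict_mono_on {z0..} z_potential"
    and z_potential_derivative: "z0 < z \<Longrightarrow> (z_potential has_real_derivative f1 z / f2 z) (at z)"
  unfolding z_potential_def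
  using primitive_continuous[OF half_open_from_atLeast quotients_continuous(2)]
    primitive_strict_mono[OF half_open_from_atLeast quotients_continuous(2)]
    primitive_has_derivative[OF half_open_from_atLeast quotients_continuous(2), of z] f1_pos f2_pos
  by auto

lemma orbit_eqI: "w0 \<le> w \<Longrightarrow> w_potential w = z_potential z \<Longrightarrow> orbit z = w"
  unfolding orbit_def
  using w_potential_strict_mono strict_mono_on_imp_inj_on by (metis atLeast_iff inv_into_f_f)

lemma orbit_props:
  assumes "z \<in> swept"
  shows orbit_ge: "w0 \<le> orbit z" and w_potential_orbit: "w_potential (orbit z) = z_potential z"
  using assms inv_into_into[of "z_potential z" w_potential "{w0..}"] f_inv_into_f[of "z_potential z" w_potential "{w0..}"]
  by (auto simp: swept_def orbit_def)

lemma swept_memI: "z0 \<le> z \<Longrightarrow> w0 \<le> w \<Longrightarrow> w_potential w = z_potential z \<Longrightarrow> z \<in> swept"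
  using rev_image_eqI[of w "{w0..}" "z_potential z" w_potential] by (simp add: swept_def)

lemma base_in_swept: "z0 \<in> swept" and orbit_base: "orbit z0 = w0"
  using w_potential_base z_potential_base by (auto simp: swept_def intro!: orbit_eqI image_eqI[of _ _ w0])

lemma orbit_less:
  assumes "z \<in> swept" "z' \<in> swept" "z < z'"
  shows "orbit z < orbit z'"
proof -
  have "z_potential z < z_potential z'"
    using assms by (intro strict_mono_onD[OF z_potential_strict_mono]) (auto simp: swept_def)
  then show ?thesis
    using strict_mono_on_less_eq_iff(2)[OF w_potential_strict_mono, of "orbit z" "orbit z'"]
      orbit_props assms by auto
qed

lemma swept_down_closed:
  assumes "z \<in> swept" "z0 \<le> z'" "z' \<le> z"
  shows "z' \<in> swept"
proof -
  have "w_potential w0 \<le> z_potential z'" "z_potential z' \<le> w_potential (orbit z)"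
    using strict_mono_on_less_eq_iff(1)[OF z_potential_strict_mono] assms w_potential_base z_potential_base w_potential_orbit[OF assms(1)]
    by (metis atLeast_iff order.trans order.refl)+
  then have "\<exists>w\<ge>w0. w \<le> orbit z \<and> w_potential w = z_potential z'"
    using orbit_ge[OF assms(1)] by (intro IVT' continuous_on_subset[OF w_potential_continuous]) auto
  then show ?thesis using assms(2) swept_memI by blast
qed

text \<open>At a large level \<open>n\<close> one of the two potentials is the smaller one, and the orbit attains the value
  \<open>n\<close> in that variable. As both variables increase along the orbit, this yields blow-up of the norm and
  shows that the swept interval has no last point.\<close>

lemma orbit_leaves_compacts: "\<exists>z\<in>swept. N \<le> z \<or> N \<le> orbit z"
proof -
  define n where "n = max N (max w0 z0)"
  have n: "w0 \<le> n" "z0 \<le> n" "N \<le> n" by (auto simp: n_def)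
  show ?thesis
  proof (cases "w_potential n \<le> z_potential n")
    case True
    have "z_potential z0 \<le> w_potential n"
      using strict_mono_on_less_eq_iff(1)[OF w_potential_strict_mono, of w0 n] n w_potential_base z_potential_base by simp
    then have "\<exists>z\<ge>z0. z \<le> n \<and> z_potential z = w_potential n"
      using True n by (intro IVT' continuous_on_subset[OF z_potential_continuous]) auto
    then obtain z where z: "z0 \<le> z" "z_potential z = w_potential n" by blast
    then have "z \<in> swept" "orbit z = n"
      using n by (auto simp: swept_def intro!: orbit_eqI)
    then show ?thesis using n by auto
  next
    case False
    have "w_potential w0 \<le> z_potential n"
      using strict_mono_on_less_eq_iff(1)[OF z_potential_strict_mono, of z0 n] n w_potential_base z_potential_base by simp
    then have "\<exists>w\<ge>w0. w \<le> n \<and> w_potential w = z_potential n"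
      using False n by (intro IVT' continuous_on_subset[OF w_potential_continuous]) auto
    then have "n \<in> swept"
      using n(2) swept_memI by blast
    then show ?thesis using n by blast
  qed
qed

lemma swept_half_open: "half_open_from z0 swept"
proof -
  have "\<exists>z'\<in>swept. z < z'" if z: "z \<in> swept" for z
  proof -
    obtain z' where z': "z' \<in> swept" "max z (orbit z) + 1 \<le> z' \<or> max z (orbit z) + 1 \<le> orbit z'"
      using orbit_leaves_compacts by blast
    have "z < z'"
    proof (rule ccontr)
      assume "\<not> z < z'"
      then have "z' \<le> z" "orbit z' \<le> orbit z"
        using orbit_less[OF z'(1) z] by (cases "z' = z"; force)+
      then show False using z'(2) by auto
    qed
    then show ?thesis using z' by blast
  qed
  moreover have "{z0..z} \<subseteq> swept" if "z \<in> swept" for z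
    using swept_down_closed[OF that] by auto
  moreover have "swept \<subseteq> {z0..}" by (auto simp: swept_def)
  ultimately show ?thesis
    unfolding half_open_from_def using base_in_swept by blast
qed

lemma orbit_continuous: "continuous_on swept orbit"
  unfolding orbit_def
proof (rule continuous_on_compose2[of "w_potential ` {w0..}" "inv_into {w0..} w_potential" swept z_potential])
  show "continuous_on (w_potential ` {w0..}) (inv_into {w0..} w_potential)"
    by (rule inv_into_continuous[OF half_open_from_atLeast w_potential_continuous w_potential_strict_mono])
  show "continuous_on swept z_potential"
    by (rule continuous_on_subset[OF z_potential_continuous]) (auto simp: swept_def)
qed (auto simp: swept_def)

lemma orbit_derivative:
  assumes z: "z \<in> swept" "z0 < z"
  shows "(orbit has_real_derivative (f1 z * g1 (orbit z)) / (f2 z * g2 (orbit z))) (at z)"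
proof -
  have gt: "w0 < orbit z"
    using orbit_less[OF base_in_swept z] by (simp add: orbit_base)
  have "(inv_into {w0..} w_potential has_real_derivative 1 / (g2 (orbit z) / g1 (orbit z))) (at (w_potential (orbit z)))"
    using gt g1_pos[of "orbit z"] g2_pos[of "orbit z"]
    by (intro inv_into_has_derivative[OF half_open_from_atLeast w_potential_continuous w_potential_strict_mono] w_potential_derivative)
      auto
  then have "(inv_into {w0..} w_potential has_real_derivative 1 / (g2 (orbit z) / g1 (orbit z))) (at (z_potential z))"
    by (simp add: w_potential_orbit[OF z(1)])
  from DERIV_chain2[OF this z_potential_derivative[OF z(2)]]
  show ?thesis
    by (simp add: orbit_def[abs_def] field_simps)
qed

lemma speed_pos: "z \<in> swept \<Longrightarrow> 0 < speed z"
  using f2_pos g2_pos orbit_ge by (auto simp: speed_def swept_def)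

lemma inverse_speed_continuous: "continuous_on swept (\<lambda>z. 1 / speed z)"
proof -
  have "continuous_on swept speed"
    unfolding speed_def[abs_def] using orbit_continuous orbit_ge
    by (intro continuous_intros continuous_on_subset[OF cont(2)] continuous_on_compose2[OF cont(4)])
      (auto simp: swept_def)
  then show ?thesis
    using speed_pos by (intro continuous_intros) (auto simp: less_imp_neq[THEN not_sym])
qed

lemma time_props:
  shows time_base: "time z0 = 0"
    and time_continuous: "continuous_on swept time"
    and time_strict_mono: "strict_mono_on swept time"
    and time_derivative: "z \<in> swept \<Longrightarrow> z0 < z \<Longrightarrow> (time has_real_derivative 1 / speed z) (at z)"
  unfolding time_def
  using primitive_continuous[OF swept_half_open inverse_speed_continuous]
    primitive_strict_mono[OF swept_half_open inverse_speed_continuous]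
    primitive_has_derivative[OF swept_half_open inverse_speed_continuous] speed_pos
  by auto

lemma time_image_down_closed:
  assumes "z \<in> swept" "0 \<le> t" "t \<le> time z"
  shows "t \<in> time ` swept"
proof -
  have sub: "{z0..z} \<subseteq> swept" and ge: "z0 \<le> z"
    using half_open_from_subset[OF swept_half_open assms(1)] by auto
  have "\<exists>x\<ge>z0. x \<le> z \<and> time x = t"
    using assms ge time_base by (intro IVT' continuous_on_subset[OF time_continuous sub]) auto
  then show ?thesis using sub by force
qed

definition z_at :: "real \<Rightarrow> real" where "z_at t = inv_into swept time t"

lemma z_at_props:
  assumes "t \<in> time ` swept"
  shows z_at_in_swept: "z_at t \<in> swept" and time_z_at: "time (z_at t) = t"
  using assms by (auto simp: z_at_def intro: inv_into_into f_inv_into_f)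

lemma z_at_greater:
  assumes "t \<in> time ` swept" "z \<in> swept" "time z < t"
  shows "z < z_at t"
  using strict_mono_on_less_eq_iff(2)[OF time_strict_mono assms(2) z_at_in_swept[OF assms(1)]] assms(3)
    time_z_at[OF assms(1)] by simp

lemma z_at_strictly_solves:
  "strictly_solves_on (time ` swept) (\<lambda>w z. f1 z * g1 w) (\<lambda>w z. f2 z * g2 w) w0 z0 (orbit \<circ> z_at) z_at"
proof -
  let ?J = "time ` swept"
  have path0: "z_at 0 = z0"
    unfolding z_at_def using strict_mono_on_imp_inj_on[OF time_strict_mono] base_in_swept time_base
    by (metis inv_into_f_f)
  have cpath: "continuous_on ?J z_at"
    using inv_into_continuous[OF swept_half_open time_continuous time_strict_mono]
    by (simp add: z_at_def[abs_def])
  have cw: "continuous_on ?J (orbit \<circ> z_at)"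
    using cpath z_at_in_swept by (intro continuous_on_compose continuous_on_subset[OF orbit_continuous]) auto
  have above: "z0 < z_at t \<and> w0 < orbit (z_at t)" if "t \<in> ?J" "0 < t" for t
  proof -
    have "z0 < z_at t"
      using z_at_greater[OF that(1) base_in_swept] that(2) time_base by simp
    then show ?thesis
      using orbit_less[OF base_in_swept z_at_in_swept[OF that(1)]] orbit_base by simp
  qed
  have der: "(z_at has_real_derivative f2 (z_at t) * g2 (orbit (z_at t))) (at t) \<and>
      (orbit \<circ> z_at has_real_derivative f1 (z_at t) * g1 (orbit (z_at t))) (at t)"
    if t: "t \<in> ?J" "0 < t" for t
  proof
    have p: "z_at t \<in> swept" "z0 < z_at t" using z_at_in_swept above t by auto
    have "(inv_into swept time has_real_derivative 1 / (1 / speed (z_at t))) (at (time (z_at t)))"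
      using p speed_pos[OF p(1)]
      by (intro inv_into_has_derivative[OF swept_half_open time_continuous time_strict_mono] time_derivative)
        auto
    then show 1: "(z_at has_real_derivative f2 (z_at t) * g2 (orbit (z_at t))) (at t)"
      unfolding time_z_at[OF t(1)] by (simp add: z_at_def[abs_def] speed_def)
    have "f2 (z_at t) \<noteq> 0" "g2 (orbit (z_at t)) \<noteq> 0"
      using speed_pos[OF p(1)] unfolding speed_def by auto
    then show "(orbit \<circ> z_at has_real_derivative f1 (z_at t) * g1 (orbit (z_at t))) (at t)"
      using DERIV_chain[OF orbit_derivative[OF p] 1] by simp
  qed
  have "0 \<le> orbit (z_at t) \<and> 0 \<le> z_at t" if "t \<in> ?J" for t
    using orbit_ge[OF z_at_in_swept[OF that]] z_at_in_swept[OF that] data_nonneg by (auto simp: swept_def)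
  then show ?thesis
    unfolding strictly_solves_on_def solves_on_def
    using path0 cpath cw above der orbit_base by auto
qed

lemma time_nonneg: "z \<in> swept \<Longrightarrow> 0 \<le> time z"
  using strict_mono_on_less_eq_iff(1)[OF time_strict_mono base_in_swept, of z] time_base
  by (auto simp: swept_def)

text \<open>The solution lives on the image of \<open>time\<close>, which is a half-line exactly when \<open>time\<close> is unbounded.\<close>

lemma global_strict_solution:
  assumes "\<And>C. \<exists>z\<in>swept. C \<le> time z"
  shows "\<exists>w z. strictly_solves_on {0..} (\<lambda>w z. f1 z * g1 w) (\<lambda>w z. f2 z * g2 w) w0 z0 w z"
proof -
  have "time ` swept = {0..}"
    using time_nonneg assms time_image_down_closed by fastforce
  then show ?thesis using z_at_strictly_solves by metis
qed

lemma blowing_up_strict_solution: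
  assumes "\<And>z. z \<in> swept \<Longrightarrow> time z \<le> C"
  shows "\<exists>T>0. \<exists>w z.
      strictly_solves_on {0..<T} (\<lambda>w z. f1 z * g1 w) (\<lambda>w z. f2 z * g2 w) w0 z0 w z \<and>
      filterlim (\<lambda>t. norm (w t, z t)) at_top (at_left T)"
proof -
  define T where "T = Sup (time ` swept)"
  have bdd: "bdd_above (time ` swept)" using assms by (auto intro!: bdd_aboveI)
  have less_T: "time z < T" if z: "z \<in> swept" for z
  proof -
    obtain z' where z': "z' \<in> swept" "z < z'"
      using half_open_from_beyond[OF swept_half_open z] by blast
    have "time z < time z'"
      using z z' by (intro strict_mono_onD[OF time_strict_mono])
    also have "\<dots> \<le> T"
      unfolding T_def using z' bdd by (intro cSup_upper) auto
    finally show ?thesis .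
  qed
  have J: "time ` swept = {0..<T}"
  proof (intro equalityI subsetI)
    fix t assume t: "t \<in> {0..<T}"
    then obtain z where "z \<in> swept" "t < time z"
      unfolding T_def using less_cSup_iff[OF _ bdd, of t] base_in_swept by auto
    then show "t \<in> time ` swept" using t time_image_down_closed by auto
  qed (use time_nonneg less_T in auto)
  have "0 < T" using less_T[OF base_in_swept] time_base by simp
  moreover have "filterlim (\<lambda>t. norm ((orbit \<circ> z_at) t, z_at t)) at_top (at_left T)"
    unfolding filterlim_at_top
  proof
    fix N :: real
    obtain z where z: "z \<in> swept" "N \<le> z \<or> N \<le> orbit z"
      using orbit_leaves_compacts by blast
    have "N \<le> norm ((orbit \<circ> z_at) t, z_at t)" if t: "time z < t" "t < T" for t
    proof -
      have tJ: "t \<in> time ` swept" unfolding J using t time_nonneg[OF z(1)] by auto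
      have "z < z_at t" "orbit z < orbit (z_at t)"
        using z_at_greater[OF tJ z(1) t(1)] orbit_less[OF z(1) z_at_in_swept[OF tJ]] by auto
      then have "N \<le> \<bar>z_at t\<bar> \<or> N \<le> \<bar>orbit (z_at t)\<bar>"
        using z(2) by linarith
      then show ?thesis
        using norm_fst_le[of "((orbit \<circ> z_at) t)" "z_at t"] norm_snd_le[of "z_at t" "((orbit \<circ> z_at) t)"]
        by auto
    qed
    then show "\<forall>\<^sub>F t in at_left T. N \<le> norm ((orbit \<circ> z_at) t, z_at t)"
      using less_T[OF z(1)] by (auto simp: eventually_at_left_field)
  qed
  ultimately show ?thesis
    using z_at_strictly_solves unfolding J by blast
qed

end

section \<open>Comparison of the travel time with the test integral\<close>

text \<open>In the variable \<open>y = F Z\<close> the two functions have derivatives \<open>1 / (h y * k (\<kappa>i * y + ei))\<close>, with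
  \<open>h = f \<circ> F\<^sup>-\<^sup>1\<close> and \<open>k\<close> nondecreasing. An affine substitution \<open>y \<mapsto> c * y + d\<close> with \<open>c \<le> 1\<close>, \<open>d \<le> 0\<close>
  decreases \<open>h\<close>, and small enough \<open>c\<close> and \<open>d\<close> also bring the argument of \<open>k\<close> for the first function
  below that for the second one. Hence the substituted first function grows at least \<open>c\<close> times as
  fast as the second one. Applied in both directions, this makes the test integrals for
  different scale factors and the travel time itself bounded or unbounded together.\<close>

lemma bounded_by_rescaled_comparison:
  fixes f k :: "real \<Rightarrow> real" and p :: real
  defines "F \<equiv> primitive p f"
  assumes f: "continuous_on {p..} f" "\<And>x. p < x \<Longrightarrow> 0 < f x" "mono_on {p..} f"
    and k: "\<And>y. 0 < y \<Longrightarrow> 0 < k y" "mono_on {0..} k"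
    and \<kappa>: "0 < \<kappa>1" "0 < \<kappa>2"
    and Z1: "p < Z1" "\<And>Z. Z1 \<le> Z \<Longrightarrow> 0 < \<kappa>1 * F Z + e1"
      "\<And>Z. Z1 \<le> Z \<Longrightarrow> (\<psi>1 has_real_derivative 1 / k (\<kappa>1 * F Z + e1)) (at Z)"
    and Z2: "p < Z2" "\<And>Z. Z2 \<le> Z \<Longrightarrow> 0 < \<kappa>2 * F Z + e2"
      "\<And>Z. Z2 \<le> Z \<Longrightarrow> (\<psi>2 has_real_derivative 1 / k (\<kappa>2 * F Z + e2)) (at Z)"
    and bound: "\<And>Z. Z1 \<le> Z \<Longrightarrow> \<psi>1 Z \<le> C"
  shows "\<exists>C'. \<forall>Z\<ge>Z2. \<psi>2 Z \<le> C'"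
proof -
  define c where "c = min 1 (\<kappa>2 / \<kappa>1)"
  define d where "d = min 0 ((e2 - e1) / \<kappa>1)"
  have c: "0 < c" "c \<le> 1" "\<kappa>1 * c \<le> \<kappa>2" and d: "d \<le> 0" "\<kappa>1 * d \<le> e2 - e1"
    using \<kappa> by (auto simp: c_def d_def min_def field_simps)
  note F_mono = primitive_strict_mono[OF half_open_from_atLeast f(1,2), folded F_def, simplified]
  note F_le = strict_mono_on_less_eq_iff(1)[OF F_mono]
  have F_image: "F ` {p..} = {0..}"
    unfolding F_def using monotone_primitive_unbounded[OF f] by (intro primitive_surjective f)
  have F_cont: "continuous_on {p..} F"
    unfolding F_def by (intro primitive_continuous half_open_from_atLeast f)
  have F_der: "(F has_real_derivative f Z) (at Z)" if "p < Z" for Z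
    unfolding F_def using that by (intro primitive_has_derivative[OF half_open_from_atLeast f(1)]) auto
  have F_nonneg: "0 \<le> F Z" if "p \<le> Z" for Z
    using F_image that by blast
  have F_Z1: "0 < F Z1"
    using strict_mono_onD[OF F_mono, of p Z1] Z1(1) by (simp add: F_def)
  \<comment> \<open>The substitution \<open>F \<mapsto> c * F + d\<close>, expressed in the variable \<open>Z\<close>.\<close>
  define \<sigma> where "\<sigma> Z = inv_into {p..} F (c * F Z + d)" for Z
  \<comment> \<open>Beyond \<open>Y\<close> the substituted variable stays in the range where \<open>\<psi>1\<close> is controlled.\<close>
  have "(F Z1 - d) / c \<in> F ` {p..}"
    unfolding F_image using F_Z1 c d by simp
  then obtain Y where Y: "p \<le> Y" "F Y = (F Z1 - d) / c" by auto
  define Z3 where "Z3 = max Y (max Z1 Z2)"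
  have Z3: "Y \<le> Z3" "Z1 \<le> Z3" "Z2 \<le> Z3" "p < Z3" using Z1(1) by (auto simp: Z3_def)
  have \<sigma>: "Z1 \<le> \<sigma> Z" "\<sigma> Z \<le> Z" "F (\<sigma> Z) = c * F Z + d" if Z: "Z3 \<le> Z" for Z
  proof -
    have "F Y \<le> F Z" using F_le[of Y Z] Y(1) Z Z3 by auto
    then have low: "F Z1 \<le> c * F Z + d"
      using Y(2) c(1) by (simp add: field_simps)
    have "c * F Z \<le> 1 * F Z"
      using F_nonneg[of Z] Z Z3 c by (intro mult_right_mono) auto
    then have up: "c * F Z + d \<le> F Z"
      using d by simp
    have "c * F Z + d \<in> F ` {p..}" unfolding F_image using low F_Z1 by simp
    then have in\<sigma>: "p \<le> \<sigma> Z" and F\<sigma>: "F (\<sigma> Z) = c * F Z + d"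
      using inv_into_into[of "c * F Z + d" F "{p..}"] by (auto simp: \<sigma>_def f_inv_into_f)
    show "F (\<sigma> Z) = c * F Z + d" by fact
    show "Z1 \<le> \<sigma> Z" using F_le[of Z1 "\<sigma> Z"] in\<sigma> F\<sigma> low Z1(1) by simp
    show "\<sigma> Z \<le> Z" using F_le[of "\<sigma> Z" Z] in\<sigma> F\<sigma> up Z Z3 by simp
  qed
  have \<sigma>_der: "(\<sigma> has_real_derivative c * f Z / f (\<sigma> Z)) (at Z)" if Z: "Z3 \<le> Z" for Z
  proof -
    have gt: "p < \<sigma> Z" using \<sigma>(1)[OF Z] Z1(1) by simp
    have "(inv_into {p..} F has_real_derivative 1 / f (\<sigma> Z)) (at (F (\<sigma> Z)))"
      using gt f(2)[OF gt]
      by (intro inv_into_has_derivative[OF half_open_from_atLeast F_cont F_mono] F_der) auto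
    then have 1: "(inv_into {p..} F has_real_derivative 1 / f (\<sigma> Z)) (at (c * F Z + d))"
      by (simp add: \<sigma>(3)[OF Z])
    have 2: "((\<lambda>Z. c * F Z + d) has_real_derivative c * f Z) (at Z)"
      using F_der[of Z] Z Z3 by (auto intro!: derivative_eq_intros)
    show ?thesis
      using DERIV_chain2[OF 1 2] by (simp add: \<sigma>_def[abs_def])
  qed
  have main: "c * \<psi>2 Z \<le> C - (\<psi>1 (\<sigma> Z3) - c * \<psi>2 Z3)" if Z: "Z3 \<le> Z" for Z
  proof -
    have "\<psi>1 (\<sigma> Z3) - c * \<psi>2 Z3 \<le> \<psi>1 (\<sigma> Z) - c * \<psi>2 Z"
    proof (rule DERIV_nonneg_imp_nondecreasing[OF Z])
      fix x assume "Z3 \<le> x" "x \<le> Z"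
      note s = \<sigma>[OF \<open>Z3 \<le> x\<close>]
      have gt: "p < \<sigma> x" "p < x" using s(1) Z1(1) Z3 \<open>Z3 \<le> x\<close> by auto
      let ?a = "k (\<kappa>1 * F (\<sigma> x) + e1)" and ?b = "k (\<kappa>2 * F x + e2)"
      have le: "\<kappa>1 * F (\<sigma> x) + e1 \<le> \<kappa>2 * F x + e2"
      proof -
        have "\<kappa>1 * F (\<sigma> x) + e1 = (\<kappa>1 * c) * F x + (\<kappa>1 * d + e1)"
          by (simp add: s(3) algebra_simps)
        also have "\<dots> \<le> \<kappa>2 * F x + e2"
          using c(3) d(2) F_nonneg[of x] gt by (intro add_mono mult_right_mono) auto
        finally show ?thesis .
      qed
      have pos: "0 < \<kappa>1 * F (\<sigma> x) + e1" using Z1(2)[OF s(1)] .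
      have ka: "0 < ?a" "?a \<le> ?b"
        using k(1)[OF pos] mono_onD[OF k(2), OF _ _ le] pos le by auto
      have fx: "0 < f (\<sigma> x)" "f (\<sigma> x) \<le> f x"
        using f(2)[OF gt(1)] mono_onD[OF f(3), of "\<sigma> x" x] gt s(2) by auto
      have "((\<lambda>Z. \<psi>1 (\<sigma> Z) - c * \<psi>2 Z) has_real_derivative
          1 / ?a * (c * f x / f (\<sigma> x)) - c * (1 / ?b)) (at x)"
        using DERIV_chain2[OF Z1(3)[OF s(1)] \<sigma>_der[OF \<open>Z3 \<le> x\<close>]] Z2(3)[of x] Z3 \<open>Z3 \<le> x\<close>
        by (intro DERIV_diff DERIV_cmult) auto
      moreover have "c * (1 / ?b) \<le> 1 / ?a * (c * f x / f (\<sigma> x))"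
      proof -
        have "1 \<le> f x / f (\<sigma> x)" using fx by simp
        moreover have "1 / ?b \<le> 1 / ?a" using ka by (simp add: frac_le)
        ultimately have "1 / ?b * 1 \<le> 1 / ?a * (f x / f (\<sigma> x))"
          using ka by (intro mult_mono) auto
        then have "c * (1 / ?b * 1) \<le> c * (1 / ?a * (f x / f (\<sigma> x)))"
          using c(1) by (intro mult_left_mono) auto
        then show ?thesis by (simp add: algebra_simps)
      qed
      ultimately show "\<exists>y. ((\<lambda>Z. \<psi>1 (\<sigma> Z) - c * \<psi>2 Z) has_real_derivative y) (at x) \<and> 0 \<le> y"
        by (intro exI conjI) auto
    qed
    then show ?thesis using bound[OF \<sigma>(1)[OF Z]] by simp
  qed
  have mono2: "\<psi>2 Z \<le> \<psi>2 Z'" if "Z2 \<le> Z" "Z \<le> Z'" for Z Z'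
  proof (rule DERIV_nonneg_imp_nondecreasing[OF that(2)])
    fix x assume "Z \<le> x" "x \<le> Z'"
    then have "Z2 \<le> x" using that by simp
    then show "\<exists>y. (\<psi>2 has_real_derivative y) (at x) \<and> 0 \<le> y"
      using Z2(3)[of x] k(1)[OF Z2(2), of x] by (meson divide_nonneg_nonneg less_imp_le zero_le_one)
  qed
  have "\<psi>2 Z \<le> (C - (\<psi>1 (\<sigma> Z3) - c * \<psi>2 Z3)) / c" if "Z2 \<le> Z" for Z
  proof -
    have "\<psi>2 Z \<le> \<psi>2 (max Z Z3)" using that by (intro mono2) auto
    also have "\<dots> \<le> (C - (\<psi>1 (\<sigma> Z3) - c * \<psi>2 Z3)) / c"
      using main[of "max Z Z3"] c(1) by (simp add: field_simps)
    finally show ?thesis .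
  qed
  then show ?thesis by blast
qed

text \<open>For \<open>W' = f Z\<close>, \<open>Z' = g W\<close> the quantity \<open>G W - F Z\<close> is conserved, so \<open>Z\<close> is reached at a time
  whose derivative in \<open>Z\<close> is \<open>1 / g (G\<^sup>-\<^sup>1 (F Z + G a - F b))\<close>. The test integrand is of the same form with
  another affine expression in \<open>F Z\<close>, so the travel time and the test integral are bounded together.
  The condition on \<open>F b\<close> and \<open>G a\<close> excludes \<open>F b = 0 < G a\<close>, where the test integrand starts at
  \<open>1 / g q\<close>, possibly infinite although \<open>g a > 0\<close>.\<close>

lemma strict_solution_criterion:
  fixes f g :: "real \<Rightarrow> real" and a b p q :: real
  defines "F \<equiv> primitive p f" and "G \<equiv> primitive q g"
  assumes f: "continuous_on {p..} f" "\<And>x. p < x \<Longrightarrow> 0 < f x" "mono_on {p..} f"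
    and g: "continuous_on {q..} g" "\<And>x. q < x \<Longrightarrow> 0 < g x" "mono_on {q..} g"
    and data: "0 \<le> q" "q \<le> a" "0 \<le> p" "p \<le> b" "0 < g a"
    and corner: "F b \<noteq> 0 \<or> G a = 0" and \<kappa>: "0 < \<kappa>"
  shows "recip_integral b (\<lambda>\<theta>. g (inv_into {q..} G (\<kappa> * F \<theta>))) = \<infinity> \<Longrightarrow>
      \<exists>W Z. strictly_solves_on {0..} (\<lambda>W Z. f Z) (\<lambda>W Z. g W) a b W Z"
    and "recip_integral b (\<lambda>\<theta>. g (inv_into {q..} G (\<kappa> * F \<theta>))) < \<infinity> \<Longrightarrow>
      \<exists>T>0. \<exists>W Z. strictly_solves_on {0..<T} (\<lambda>W Z. f Z) (\<lambda>W Z. g W) a b W Z \<and>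
        filterlim (\<lambda>t. norm (W t, Z t)) at_top (at_left T)"
proof -
  have g_ge: "0 < g W" if "a \<le> W" for W
    using mono_onD[OF g(3), of a W] data that by auto
  interpret S: separable_system f "\<lambda>_. 1" "\<lambda>_. 1" g a b
    using data f(2) g_ge
    by unfold_locales (auto intro: continuous_on_subset[OF f(1)] continuous_on_subset[OF g(1)])
  note F_mono = primitive_strict_mono[OF half_open_from_atLeast f(1,2), folded F_def, simplified]
  note G_mono = primitive_strict_mono[OF half_open_from_atLeast g(1,2), folded G_def, simplified]
  note F_le = strict_mono_on_less_eq_iff[OF F_mono] and G_le = strict_mono_on_less_eq_iff[OF G_mono]
  have G_image: "G ` {q..} = {0..}"
    unfolding G_def using monotone_primitive_unbounded[OF g] by (intro primitive_surjective g)
  have F_cont: "continuous_on {p..} F" and G_cont: "continuous_on {q..} G"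
    unfolding F_def G_def by (intro primitive_continuous half_open_from_atLeast f g)+
  have F_nonneg: "0 \<le> F Z" if "p \<le> Z" for Z
    using F_le(1)[of p Z] that by (simp add: F_def)
  have Ginv: "q \<le> inv_into {q..} G y" "G (inv_into {q..} G y) = y" if "0 \<le> y" for y
    using that G_image inv_into_into[of y G "{q..}"] f_inv_into_f[of y G "{q..}"] by auto
  have Ginv_cont: "continuous_on {0..} (inv_into {q..} G)"
    using inv_into_continuous[OF half_open_from_atLeast G_cont G_mono] by (simp add: G_image)
  have Ginv_le: "inv_into {q..} G x \<le> inv_into {q..} G y" if "0 \<le> x" "x \<le> y" for x y
    using G_le(1)[of "inv_into {q..} G x" "inv_into {q..} G y"] Ginv[of x] Ginv[of y] that by simp
  define k where "k y = g (inv_into {q..} G y)" for y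
  have k_mono: "mono_on {0..} k"
    unfolding k_def using Ginv Ginv_le by (intro mono_onI mono_onD[OF g(3)]) auto
  have k_pos: "0 < k y" if "0 < y" for y
    unfolding k_def
  proof (rule g(2))
    show "q < inv_into {q..} G y"
      using G_le(2)[of q "inv_into {q..} G y"] Ginv[of y] that by (simp add: G_def)
  qed
  have k_cont: "continuous_on {0..} k"
    unfolding k_def using Ginv by (intro continuous_on_compose2[OF g(1) Ginv_cont]) auto

  have A: "S.w_potential W = G W - G a" if "a \<le> W" for W
    unfolding S.w_potential_def using that data
    by (intro primitive_eqI continuous_on_subset[OF G_cont])
      (auto simp: G_def intro!: continuous_on_subset[OF g(1)] primitive_has_derivative[OF half_open_from_atLeast g(1)])
  have B: "S.z_potential Z = F Z - F b" if "b \<le> Z" for Z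
    unfolding S.z_potential_def using that data
    by (intro primitive_eqI continuous_on_subset[OF F_cont])
      (auto simp: F_def intro!: continuous_on_subset[OF f(1)] primitive_has_derivative[OF half_open_from_atLeast f(1)])
  have Ga: "0 \<le> G a" using G_image data by auto
  have orbit: "Z \<in> S.swept" "S.orbit Z = inv_into {q..} G (F Z + (G a - F b))" if Z: "b \<le> Z" for Z
  proof -
    let ?y = "F Z + (G a - F b)"
    have y: "G a \<le> ?y" using F_le(1)[of b Z] Z data by simp
    then have W: "a \<le> inv_into {q..} G ?y"
      using G_le(1)[of a "inv_into {q..} G ?y"] Ginv[of ?y] Ga data by simp
    have AB: "S.w_potential (inv_into {q..} G ?y) = S.z_potential Z"
      using A[OF W] B[OF Z] Ginv[of ?y] y Ga by simp
    show "S.orbit Z = inv_into {q..} G ?y" using W AB by (rule S.orbit_eqI)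
    show "Z \<in> S.swept" using Z W AB by (rule S.swept_memI)
  qed
  have I: "S.swept = {b..}" using orbit(1) by (auto simp: S.swept_def)
  \<comment> \<open>The factor \<open>1\<close> and, below, the summand \<open>0\<close> give both derivatives the shape that the comparison needs.\<close>
  have time_der: "(S.time has_real_derivative 1 / k (1 * F Z + (G a - F b))) (at Z)" if "b + 1 \<le> Z" for Z
    using S.time_derivative[of Z] that orbit[of Z] by (simp add: S.speed_def k_def)

  define H where "H \<theta> = k (\<kappa> * F \<theta>)" for \<theta>
  have H_pos: "0 < H \<theta>" if \<theta>: "b \<le> \<theta>" for \<theta>
  proof (cases "F \<theta> = 0")
    case True
    then have "F b = 0" using F_le(1)[of b \<theta>] F_nonneg[of b] \<theta> data by auto
    then have "G a = G q" using corner by (simp add: G_def)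
    then have "a = q" using G_le(2)[of q a] data by (cases "a = q") auto
    moreover have "inv_into {q..} G 0 = q"
      using strict_mono_on_imp_inj_on[OF G_mono] inv_into_f_f[of G "{q..}" q] by (simp add: G_def)
    ultimately show ?thesis using True data by (simp add: H_def k_def)
  next
    case False
    then show ?thesis
      using F_nonneg[of \<theta>] \<theta> data \<kappa> unfolding H_def by (intro k_pos) simp
  qed
  have H_cont: "continuous_on {b..} H"
    unfolding H_def using F_nonneg data \<kappa>
    by (intro continuous_on_compose2[OF k_cont] continuous_intros continuous_on_subset[OF F_cont]) auto
  have rH: "continuous_on {b..} (\<lambda>\<theta>. 1 / H \<theta>)"
    using H_pos by (intro continuous_intros H_cont) (auto simp: less_imp_neq[THEN not_sym])
  define \<Phi> where "\<Phi> = primitive b (\<lambda>\<theta>. 1 / H \<theta>)"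
  have \<Phi>_mono: "strict_mono_on {b..} \<Phi>"
    unfolding \<Phi>_def using H_pos by (intro primitive_strict_mono[OF half_open_from_atLeast rH]) auto
  have \<Phi>_der: "(\<Phi> has_real_derivative 1 / k (\<kappa> * F Z + 0)) (at Z)" if "b + 1 \<le> Z" for Z
    using primitive_has_derivative[OF half_open_from_atLeast rH, of Z] that by (simp add: \<Phi>_def H_def)
  have F_pos: "F b < F Z" if "b + 1 \<le> Z" for Z
    using F_le(2)[of b Z] that data by simp
  have arg_pos: "0 < 1 * F Z + (G a - F b)" "0 < \<kappa> * F Z + 0" if "b + 1 \<le> Z" for Z
    using F_pos[OF that] Ga F_nonneg[of b] data \<kappa> by auto
  have extend: "\<exists>C. \<forall>Z\<ge>b. \<psi> Z \<le> C" if bd: "\<exists>C. \<forall>Z\<ge>b + 1. \<psi> Z \<le> C" and mono: "strict_mono_on {b..} \<psi>" for \<psi> :: "real \<Rightarrow> real"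
  proof -
    obtain C where C: "\<And>Z. b + 1 \<le> Z \<Longrightarrow> \<psi> Z \<le> C" using bd by blast
    have "\<psi> Z \<le> C" if "b \<le> Z" for Z
      using C[of "Z + 1"] strict_mono_on_less_eq_iff(1)[OF mono, of Z "Z + 1"] that by simp
    then show ?thesis by blast
  qed
  have fin: "recip_integral b H < \<infinity> \<longleftrightarrow> (\<exists>C. \<forall>Z\<ge>b. \<Phi> Z \<le> C)"
    unfolding \<Phi>_def by (rule recip_integral_finite_iff[OF H_cont H_pos])
  have int: "recip_integral b (\<lambda>\<theta>. g (inv_into {q..} G (\<kappa> * F \<theta>))) = recip_integral b H"
    by (simp add: H_def[abs_def] k_def)
  have time_mono: "strict_mono_on {b..} S.time" using S.time_strict_mono by (simp add: I)
  have b1: "p < b + 1" using data by simp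

  {
    assume "recip_integral b (\<lambda>\<theta>. g (inv_into {q..} G (\<kappa> * F \<theta>))) = \<infinity>"
    then have unb: "\<nexists>C. \<forall>Z\<ge>b. \<Phi> Z \<le> C" using fin int by simp
    have "\<exists>z\<in>S.swept. C \<le> S.time z" for C
    proof (rule ccontr)
      assume "\<not> (\<exists>z\<in>S.swept. C \<le> S.time z)"
      then have C: "S.time Z \<le> C" if "b + 1 \<le> Z" for Z
        using that orbit(1)[of Z] by fastforce
      have "\<exists>C'. \<forall>Z\<ge>b + 1. \<Phi> Z \<le> C'"
        by (rule bounded_by_rescaled_comparison[of p f k 1 \<kappa> "b + 1" "G a - F b" S.time "b + 1" 0 \<Phi> C,
              folded F_def])
          (fact f k_pos k_mono b1 arg_pos time_der \<Phi>_der C \<kappa> zero_less_one)+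
      then show False using extend[OF _ \<Phi>_mono] unb by blast
    qed
    then show "\<exists>W Z. strictly_solves_on {0..} (\<lambda>W Z. f Z) (\<lambda>W Z. g W) a b W Z"
      using S.global_strict_solution by simp
  next
    assume "recip_integral b (\<lambda>\<theta>. g (inv_into {q..} G (\<kappa> * F \<theta>))) < \<infinity>"
    then obtain C where C: "\<And>Z. b \<le> Z \<Longrightarrow> \<Phi> Z \<le> C" using fin int by auto
    then have C: "\<Phi> Z \<le> C" if "b + 1 \<le> Z" for Z using that by simp
    have "\<exists>C'. \<forall>Z\<ge>b + 1. S.time Z \<le> C'"
      by (rule bounded_by_rescaled_comparison[of p f k \<kappa> 1 "b + 1" 0 \<Phi> "b + 1" "G a - F b" S.time C,
            folded F_def])
        (fact f k_pos k_mono b1 arg_pos time_der \<Phi>_der C \<kappa> zero_less_one)+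
    then obtain C' where "\<And>Z. Z \<in> S.swept \<Longrightarrow> S.time Z \<le> C'"
      using extend[OF _ time_mono] by (auto simp: I)
    from S.blowing_up_strict_solution[OF this]
    show "\<exists>T>0. \<exists>W Z. strictly_solves_on {0..<T} (\<lambda>W Z. f Z) (\<lambda>W Z. g W) a b W Z \<and>
        filterlim (\<lambda>t. norm (W t, Z t)) at_top (at_left T)"
      by simp
  }
qed

section \<open>Admissible nonlinearities\<close>

lemma admissible_properties:
  assumes "admissible h"
  shows admissible_continuous: "continuous_on {0..} h"
    and admissible_mono: "mono_on {0..} h"
    and admissible_nonneg: "0 \<le> x \<Longrightarrow> 0 \<le> h x"
    and admissible_pos: "0 < x \<Longrightarrow> 0 < h x"
    and admissible_derivative_at_0: "\<exists>L\<ge>0. (h has_real_derivative L) (at 0 within {0..})"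
proof -
  obtain D :: "nat \<Rightarrow> real \<Rightarrow> real" where D: "D 0 = h"
      "\<And>n x. 0 \<le> x \<Longrightarrow> (D n has_real_derivative D (Suc n) x) (at x within {0..})"
    using assms unfolding admissible_def smooth_halfline_def by blast
  have der: "(h has_real_derivative D 1 x) (at x within {0..})" if "0 \<le> x" for x
    using D(2)[OF that, of 0] D(1) by simp
  have D1: "0 \<le> D 1 x" if x: "0 \<le> x" for x
  proof -
    have "x islimpt {x..x + 1}" by (simp add: islimpt_Icc)
    then have "x islimpt {0..}" by (rule islimpt_subset) (use x in auto)
    then have "at x within {0..} \<noteq> bot" by (simp add: trivial_limit_within)
    then have "vector_derivative h (at x within {0..}) = D 1 x"
      using der[OF x] by (intro vector_derivative_within)
        (simp_all add: has_real_derivative_iff_has_vector_derivative)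
    then show ?thesis using assms x unfolding admissible_def by auto
  qed
  show cont: "continuous_on {0..} h"
    using der by (intro DERIV_continuous_on) auto
  show mono: "mono_on {0..} h"
  proof (rule mono_onI)
    fix x y :: real assume xy: "x \<in> {0..}" "y \<in> {0..}" "x \<le> y"
    show "h x \<le> h y"
    proof (rule DERIV_nonneg_imp_increasing_open[OF xy(3)])
      fix t assume "x < t" "t < y"
      then have t: "0 < t" using xy by auto
      then have "at t within {0..} = at t" by (intro at_within_interior) simp
      then show "\<exists>d. (h has_real_derivative d) (at t) \<and> 0 \<le> d"
        using der[of t] D1[of t] t by auto
    qed (use xy in \<open>auto intro: continuous_on_subset[OF cont]\<close>)
  qed
  show nonneg: "0 \<le> h x" if "0 \<le> x" for x
    using assms that unfolding admissible_def by auto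
  show "0 < h x" if x: "0 < x"
  proof -
    obtain y where y: "0 < y" "y < x" "h y \<noteq> 0"
      using assms x unfolding admissible_def by (metis greaterThanLessThan_iff order_refl)
    then have "0 < h y" using nonneg[of y] by simp
    also have "h y \<le> h x" using y by (intro mono_onD[OF mono]) auto
    finally show ?thesis .
  qed
  show "\<exists>L\<ge>0. (h has_real_derivative L) (at 0 within {0..})"
    using der[of 0] D1[of 0] by auto
qed

text \<open>A smooth function vanishing at \<open>0\<close> is at most linear there, and \<open>1 / s\<close> is not integrable at \<open>0\<close>.\<close>

lemma recip_primitive_exists_imp_pos:
  assumes h: "admissible h" and c: "0 \<le> c" and ex: "recip_primitive_exists c h" and x: "c \<le> x"
  shows "0 < h x"
proof (rule ccontr)
  assume "\<not> 0 < h x"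
  moreover from this have "x = 0" "c = 0"
    using admissible_pos[OF h, of x] c x by force+
  ultimately have h0: "h 0 = 0"
    using admissible_nonneg[OF h, of 0] by simp
  obtain L where L: "0 \<le> L" "(h has_real_derivative L) (at 0 within {0..})"
    using admissible_derivative_at_0[OF h] by blast
  define k where "k = L + 1"
  have k: "0 < k" "L < k" using L by (auto simp: k_def)
  have "((\<lambda>y. h y / y) \<longlongrightarrow> L) (at 0 within {0..})"
    using L(2) h0 by (simp add: has_field_derivative_iff)
  then have "\<forall>\<^sub>F y in at 0 within {0..}. h y / y < k"
    using k(2) by (rule order_tendstoD)
  then obtain \<delta>' where \<delta>': "0 < \<delta>'" "\<And>y. 0 < y \<Longrightarrow> y < \<delta>' \<Longrightarrow> h y / y < k"
    unfolding eventually_at by (auto simp: dist_real_def)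
  define \<delta> where "\<delta> = \<delta>' / 2"
  have \<delta>: "0 < \<delta>" "\<And>y. 0 < y \<Longrightarrow> y \<le> \<delta> \<Longrightarrow> 1 / (k * y) \<le> 1 / h y"
  proof -
    show "0 < \<delta>" using \<delta>' by (simp add: \<delta>_def)
    fix y assume y: "0 < y" "y \<le> \<delta>"
    then have "h y \<le> k * y" using \<delta>'(2)[of y] \<delta>'(1) by (simp add: \<delta>_def field_simps)
    then show "1 / (k * y) \<le> 1 / h y"
      using admissible_pos[OF h y(1)] by (intro divide_left_mono) (auto simp: k y)
  qed
  have int: "(\<lambda>s. 1 / h s) integrable_on {0..\<delta>}"
    using ex \<delta>(1) \<open>c = 0\<close> by (simp add: recip_primitive_exists_def)
  define S where "S = integral {0..\<delta>} (\<lambda>s. 1 / h s)"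
  have S: "0 \<le> S"
    unfolding S_def using admissible_nonneg[OF h] by (intro integral_nonneg[OF int]) auto
  \<comment> \<open>Chosen so small that the integral of \<open>1 / (k * s)\<close> over \<open>[e, \<delta>]\<close> is \<open>S + 1 / k\<close>.\<close>
  define e where "e = \<delta> * exp (- (k * S) - 1)"
  have "0 \<le> k * S" using S k by simp
  then have e: "0 < e" "e \<le> \<delta>"
    using \<delta>(1) by (auto simp: e_def)
  have int_e: "(\<lambda>s. 1 / h s) integrable_on {e..\<delta>}"
    by (rule integrable_on_subinterval[OF int]) (use e in auto)
  have "((\<lambda>s. 1 / (k * s)) has_integral ln \<delta> / k - ln e / k) {e..\<delta>}"
  proof (rule fundamental_theorem_of_calculus[OF e(2)])
    fix s assume "s \<in> {e..\<delta>}"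
    then have "((\<lambda>s. ln s / k) has_real_derivative 1 / (k * s)) (at s within {e..\<delta>})"
      using e k by (auto intro!: derivative_eq_intros simp: field_simps)
    then show "((\<lambda>s. ln s / k) has_vector_derivative 1 / (k * s)) (at s within {e..\<delta>})"
      by (simp add: has_real_derivative_iff_has_vector_derivative)
  qed
  then have "ln \<delta> / k - ln e / k \<le> integral {e..\<delta>} (\<lambda>s. 1 / h s)"
    by (rule has_integral_le[OF _ integrable_integral[OF int_e]]) (use \<delta> e in auto)
  also have "\<dots> \<le> S"
    unfolding S_def using int_e int admissible_nonneg[OF h] e
    by (intro integral_subset_le) auto
  finally have "ln \<delta> - ln e \<le> k * S" using k by (simp add: field_simps)
  moreover have "ln e = ln \<delta> - k * S - 1"
    using \<delta>(1) by (simp add: e_def ln_mult)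
  ultimately show False by simp
qed

section \<open>Passing between the original and the transformed system\<close>

text \<open>In the coordinate \<open>\<integral> ds / h s\<close> the factor \<open>h\<close> disappears from an equation \<open>x' = h x * u\<close>. Divergence of the
  integral means that the coordinate maps \<open>[c, \<infinity>)\<close> onto \<open>[0, \<infinity>)\<close>, so that neither global
  existence nor blow-up is affected.\<close>

locale reciprocal_coordinate =
  fixes c :: real and h :: "real \<Rightarrow> real"
  assumes base_nonneg: "0 \<le> c" and cont: "continuous_on {c..} h"
    and pos: "c \<le> x \<Longrightarrow> 0 < h x" and divergent: "recip_integral c h = \<infinity>"
begin

abbreviation coord :: "real \<Rightarrow> real" where "coord \<equiv> primitive c (\<lambda>s. 1 / h s)"

abbreviation uncoord :: "real \<Rightarrow> real" where "uncoord \<equiv> inv_into {c..} coord"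

lemma recip_continuous: "continuous_on {c..} (\<lambda>s. 1 / h s)"
  using pos by (intro continuous_intros cont) (auto simp: less_imp_neq[THEN not_sym])

lemma coord_strict_mono: "strict_mono_on {c..} coord"
  using pos by (intro primitive_strict_mono[OF half_open_from_atLeast recip_continuous]) auto

lemmas coord_le_iff = strict_mono_on_less_eq_iff[OF coord_strict_mono]

lemma coord_continuous: "continuous_on {c..} coord"
  by (rule primitive_continuous[OF half_open_from_atLeast recip_continuous])

lemma coord_image: "coord ` {c..} = {0..}"
proof (rule primitive_surjective[OF recip_continuous])
  show "\<exists>x\<ge>c. C \<le> coord x" for C
  proof (rule ccontr)
    assume "\<not> (\<exists>x\<ge>c. C \<le> coord x)"
    then have "\<exists>C. \<forall>x\<ge>c. coord x \<le> C" by (meson linorder_le_cases)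
    then show False using recip_integral_finite_iff[OF cont pos] divergent by simp
  qed
qed (use pos in auto)

lemma coord_nonneg: "c \<le> x \<Longrightarrow> 0 \<le> coord x"
  using coord_image by auto

lemma uncoord_ge: "0 \<le> y \<Longrightarrow> c \<le> uncoord y"
  using coord_image inv_into_into[of y coord "{c..}"] by simp

lemma coord_uncoord: "0 \<le> y \<Longrightarrow> coord (uncoord y) = y"
  using coord_image by (intro f_inv_into_f) simp

lemma uncoord_coord: "c \<le> x \<Longrightarrow> uncoord (coord x) = x"
  using strict_mono_on_imp_inj_on[OF coord_strict_mono] by simp

lemma uncoord_continuous: "continuous_on {0..} uncoord"
  using inv_into_continuous[OF half_open_from_atLeast coord_continuous coord_strict_mono]
  by (simp add: coord_image)

lemma le_uncoord: "c \<le> x \<Longrightarrow> 0 \<le> y \<Longrightarrow> coord x \<le> y \<Longrightarrow> x \<le> uncoord y"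
  using coord_le_iff(1)[of x "uncoord y"] uncoord_ge[of y] coord_uncoord[of y] by simp

lemma uncoord_mono: "0 \<le> x \<Longrightarrow> x \<le> y \<Longrightarrow> uncoord x \<le> uncoord y"
  using le_uncoord[of "uncoord x" y] uncoord_ge[of x] coord_uncoord[of x] by simp

lemma uncoord_gt: "0 < y \<Longrightarrow> c < uncoord y"
  using coord_le_iff(2)[of c "uncoord y"] uncoord_ge[of y] coord_uncoord[of y] by simp

lemma uncoord_derivative:
  assumes "0 < y"
  shows "(uncoord has_real_derivative h (uncoord y)) (at y)"
proof -
  have gt: "c < uncoord y" by (rule uncoord_gt[OF assms])
  have "(uncoord has_real_derivative 1 / (1 / h (uncoord y))) (at (coord (uncoord y)))"
    using gt pos[of "uncoord y"]
    by (intro inv_into_has_derivative[OF half_open_from_atLeast coord_continuous coord_strict_mono]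
        primitive_has_derivative[OF half_open_from_atLeast recip_continuous]) auto
  then show ?thesis using coord_uncoord[of y] assms by simp
qed

lemma admissible_uncoord:
  assumes f: "admissible f"
  shows "continuous_on {0..} (\<lambda>y. f (uncoord y))" and "mono_on {0..} (\<lambda>y. f (uncoord y))"
    and "0 < y \<Longrightarrow> 0 < f (uncoord y)"
proof -
  have ge: "0 \<le> uncoord y" if "0 \<le> y" for y
    using uncoord_ge[OF that] base_nonneg by simp
  show "continuous_on {0..} (\<lambda>y. f (uncoord y))"
    using ge by (intro continuous_on_compose2[OF admissible_continuous[OF f] uncoord_continuous]) auto
  show "mono_on {0..} (\<lambda>y. f (uncoord y))"
    using ge uncoord_mono by (intro mono_onI mono_onD[OF admissible_mono[OF f]]) auto
  show "0 < f (uncoord y)" if "0 < y"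
    using uncoord_gt[OF that] base_nonneg by (intro admissible_pos[OF f]) simp
qed

end

lemma admissible_reciprocal_coordinate:
  assumes "admissible h" "0 \<le> c" "recip_primitive_exists c h" "recip_integral c h = \<infinity>"
  shows "reciprocal_coordinate c h"
  using assms recip_primitive_exists_imp_pos[OF assms(1-3)]
  by unfold_locales (auto intro: continuous_on_subset[OF admissible_continuous])

locale transformed_system =
  W: reciprocal_coordinate c1 g1 + Z: reciprocal_coordinate c2 f2 for c1 g1 c2 f2 +
  fixes f1 g2 :: "real \<Rightarrow> real" and w0 z0 :: real
  assumes data: "c1 \<le> w0" "c2 \<le> z0"
begin

lemma solution_pulls_back:
  assumes "strictly_solves_on J (\<lambda>w z. f1 (Z.uncoord z)) (\<lambda>w z. g2 (W.uncoord w))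
      (W.coord w0) (Z.coord z0) w z"
  shows "solves_on J (\<lambda>w z. f1 z * g1 w) (\<lambda>w z. f2 z * g2 w) w0 z0
      (\<lambda>t. W.uncoord (w t)) (\<lambda>t. Z.uncoord (z t))"
proof -
  have sol: "w 0 = W.coord w0" "z 0 = Z.coord z0" "continuous_on J w" "continuous_on J z"
      "\<And>t. t \<in> J \<Longrightarrow> 0 \<le> w t \<and> 0 \<le> z t"
      "\<And>t. t \<in> J \<Longrightarrow> 0 < t \<Longrightarrow> (w has_real_derivative f1 (Z.uncoord (z t))) (at t)"
      "\<And>t. t \<in> J \<Longrightarrow> 0 < t \<Longrightarrow> (z has_real_derivative g2 (W.uncoord (w t))) (at t)"
      "\<And>t. t \<in> J \<Longrightarrow> 0 < t \<Longrightarrow> W.coord w0 < w t \<and> Z.coord z0 < z t"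
    using assms unfolding strictly_solves_on_def solves_on_def by auto
  have pos: "0 < w t" "0 < z t" if "t \<in> J" "0 < t" for t
    using sol(8)[OF that] W.coord_nonneg[OF data(1)] Z.coord_nonneg[OF data(2)] by auto
  show ?thesis
    unfolding solves_on_def
  proof (intro conjI ballI impI)
    show "W.uncoord (w 0) = w0" "Z.uncoord (z 0) = z0"
      using sol(1,2) W.uncoord_coord Z.uncoord_coord data by auto
    show "continuous_on J (\<lambda>t. W.uncoord (w t))" "continuous_on J (\<lambda>t. Z.uncoord (z t))"
      using sol(3,4,5)
      by (auto intro!: continuous_on_compose2[OF W.uncoord_continuous]
          continuous_on_compose2[OF Z.uncoord_continuous])
    fix t assume t: "t \<in> J"
    show "0 \<le> W.uncoord (w t)" "0 \<le> Z.uncoord (z t)"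
      using W.uncoord_ge[of "w t"] Z.uncoord_ge[of "z t"] sol(5)[OF t] W.base_nonneg Z.base_nonneg
      by auto
    assume t0: "0 < t"
    show "((\<lambda>t. W.uncoord (w t)) has_real_derivative f1 (Z.uncoord (z t)) * g1 (W.uncoord (w t))) (at t)"
      using DERIV_chain2[OF W.uncoord_derivative[OF pos(1)[OF t t0]] sol(6)[OF t t0]]
      by (simp add: mult.commute)
    show "((\<lambda>t. Z.uncoord (z t)) has_real_derivative f2 (Z.uncoord (z t)) * g2 (W.uncoord (w t))) (at t)"
      using DERIV_chain2[OF Z.uncoord_derivative[OF pos(2)[OF t t0]] sol(7)[OF t t0]] .
  qed
qed

lemma unboundedness_pulls_back:
  assumes lim: "filterlim (\<lambda>t. norm (w t :: real, z t :: real)) at_top (at_left (T :: real))"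
    and nonneg: "\<And>t. 0 \<le> t \<Longrightarrow> t < T \<Longrightarrow> 0 \<le> w t \<and> 0 \<le> z t" and "0 < T"
  shows "filterlim (\<lambda>t. norm (W.uncoord (w t), Z.uncoord (z t))) at_top (at_left T)"
  unfolding filterlim_at_top
proof
  fix N :: real
  define n where "n = max N (max c1 c2)"
  have n: "c1 \<le> n" "c2 \<le> n" "N \<le> n" by (auto simp: n_def)
  \<comment> \<open>Nonnegative \<open>w\<close> and \<open>z\<close> with sum at least this large cannot both lie below their threshold.\<close>
  have "\<forall>\<^sub>F t in at_left T. W.coord n + Z.coord n \<le> norm (w t, z t)"
    using lim unfolding filterlim_at_top by blast
  moreover have "\<forall>\<^sub>F t in at_left T. 0 < t \<and> t < T"
    using \<open>0 < T\<close> unfolding eventually_at_left_field by blast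
  ultimately show "\<forall>\<^sub>F t in at_left T. N \<le> norm (W.uncoord (w t), Z.uncoord (z t))"
  proof eventually_elim
    case (elim t)
    then have wz: "0 \<le> w t" "0 \<le> z t" using nonneg[of t] by auto
    then have "W.coord n + Z.coord n \<le> w t + z t"
      using elim norm_Pair_le[of "w t" "z t"] by simp
    then have "W.coord n \<le> w t \<or> Z.coord n \<le> z t" by linarith
    then have "n \<le> W.uncoord (w t) \<or> n \<le> Z.uncoord (z t)"
      using W.le_uncoord Z.le_uncoord n wz by blast
    then have "N \<le> \<bar>W.uncoord (w t)\<bar> \<or> N \<le> \<bar>Z.uncoord (z t)\<bar>"
      using n by linarith
    then show ?case
      using norm_fst_le[of "W.uncoord (w t)" "Z.uncoord (z t)"]
        norm_snd_le[of "Z.uncoord (z t)" "W.uncoord (w t)"] by auto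
  qed
qed

text \<open>Both halves of the dichotomy rest on a single test integral with an arbitrary factor \<open>\<kappa>\<close>. Its
  counterpart for the other variable is the same statement with the two equations interchanged.\<close>

lemma test_integral_decides:
  fixes p q :: real
  defines "f \<equiv> \<lambda>z. f1 (Z.uncoord z)" and "g \<equiv> \<lambda>w. g2 (W.uncoord w)"
  defines "F \<equiv> primitive p f" and "G \<equiv> primitive q g"
  assumes adm: "admissible f1" "admissible g2"
    and pq: "0 \<le> p" "p \<le> Z.coord z0" "0 \<le> q" "q \<le> W.coord w0" and start: "0 < g2 w0"
    and corner: "F (Z.coord z0) \<noteq> 0 \<or> G (W.coord w0) = 0" and \<kappa>: "0 < \<kappa>"
  shows "recip_integral (Z.coord z0) (\<lambda>\<theta>. g (inv_into {q..} G (\<kappa> * F \<theta>))) = \<infinity> \<Longrightarrow>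
      exists_globally (\<lambda>w z. f z) (\<lambda>w z. g w) (W.coord w0) (Z.coord z0) \<and>
      exists_globally (\<lambda>w z. f1 z * g1 w) (\<lambda>w z. f2 z * g2 w) w0 z0" (is "?inf \<Longrightarrow> ?global")
    and "recip_integral (Z.coord z0) (\<lambda>\<theta>. g (inv_into {q..} G (\<kappa> * F \<theta>))) < \<infinity> \<Longrightarrow>
      blows_up (\<lambda>w z. f z) (\<lambda>w z. g w) (W.coord w0) (Z.coord z0) \<and>
      blows_up (\<lambda>w z. f1 z * g1 w) (\<lambda>w z. f2 z * g2 w) w0 z0" (is "?fin \<Longrightarrow> ?blow")
proof -
  have f: "continuous_on {p..} f" "\<And>x. p < x \<Longrightarrow> 0 < f x" "mono_on {p..} f"
    unfolding f_def using pq Z.admissible_uncoord[OF adm(1)]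
    by (auto intro: continuous_on_subset mono_on_subset)
  have g: "continuous_on {q..} g" "\<And>x. q < x \<Longrightarrow> 0 < g x" "mono_on {q..} g"
    unfolding g_def using pq W.admissible_uncoord[OF adm(2)]
    by (auto intro: continuous_on_subset mono_on_subset)
  have g0: "0 < g (W.coord w0)"
    using start by (simp add: g_def W.uncoord_coord data)
  have global: "\<exists>w z. strictly_solves_on {0..} (\<lambda>w z. f z) (\<lambda>w z. g w) (W.coord w0) (Z.coord z0) w z"
    if ?inf
    by (rule strict_solution_criterion(1)[of p f q g "W.coord w0" "Z.coord z0" \<kappa>, folded F_def G_def])
      (fact f g pq g0 corner \<kappa> that)+
  have blow: "\<exists>T>0. \<exists>w z.
      strictly_solves_on {0..<T} (\<lambda>w z. f z) (\<lambda>w z. g w) (W.coord w0) (Z.coord z0) w z \<and>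
      filterlim (\<lambda>t. norm (w t, z t)) at_top (at_left T)"
    if ?fin
    by (rule strict_solution_criterion(2)[of p f q g "W.coord w0" "Z.coord z0" \<kappa>, folded F_def G_def])
      (fact f g pq g0 corner \<kappa> that)+
  {
    assume ?inf
    then obtain w z where
      s: "strictly_solves_on {0..} (\<lambda>w z. f z) (\<lambda>w z. g w) (W.coord w0) (Z.coord z0) w z"
      using global by blast
    then have "solves_on {0..} (\<lambda>w z. f z) (\<lambda>w z. g w) (W.coord w0) (Z.coord z0) w z"
      by (simp add: strictly_solves_on_def)
    then show ?global
      using solution_pulls_back[OF s[unfolded f_def g_def]] unfolding exists_globally_def by blast
  next
    assume ?fin
    then obtain T w z where T: "0 < T" and
      s: "strictly_solves_on {0..<T} (\<lambda>w z. f z) (\<lambda>w z. g w) (W.coord w0) (Z.coord z0) w z" and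
      lim: "filterlim (\<lambda>t. norm (w t, z t)) at_top (at_left T)"
      using blow by blast
    then have s': "solves_on {0..<T} (\<lambda>w z. f z) (\<lambda>w z. g w) (W.coord w0) (Z.coord z0) w z"
      by (simp add: strictly_solves_on_def)
    have "0 \<le> w t \<and> 0 \<le> z t" if "0 \<le> t" "t < T" for t
      using s' that by (auto simp: solves_on_def)
    from unboundedness_pulls_back[OF lim this T] show ?blow
      using T s' lim solution_pulls_back[OF s[unfolded f_def g_def]] unfolding blows_up_def by blast
  }
qed

end

section \<open>The criteria\<close>

lemma solves_on_swap:
  "solves_on J P Q a b w z \<longleftrightarrow> solves_on J (\<lambda>w z. Q z w) (\<lambda>w z. P z w) b a z w"
  by (auto simp: solves_on_def)

lemma exists_globally_swap:
  "exists_globally P Q a b \<longleftrightarrow> exists_globally (\<lambda>w z. Q z w) (\<lambda>w z. P z w) b a"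
  unfolding exists_globally_def using solves_on_swap by metis

lemma blows_up_swap:
  "blows_up P Q a b \<longleftrightarrow> blows_up (\<lambda>w z. Q z w) (\<lambda>w z. P z w) b a"
proof -
  have norm: "norm (x, y) = norm (y, x)" for x y :: real
    by (simp add: norm_Pair add.commute)
  have "blows_up (\<lambda>w z. Q z w) (\<lambda>w z. P z w) b a" if "blows_up P Q a b" for P Q a b
    using that unfolding blows_up_def solves_on_swap[of _ P] by (subst (asm) norm) blast
  from this[of P Q a b] this[of "\<lambda>w z. Q z w" "\<lambda>w z. P z w" b a] show ?thesis by auto
qed

lemma exists_globally_equilibrium:
  assumes "P a b = 0" "Q a b = 0" "0 \<le> a" "0 \<le> b"
  shows "exists_globally P Q a b"
  unfolding exists_globally_def solves_on_def
  using assms by (intro exI[of _ "\<lambda>_. a"] exI[of _ "\<lambda>_. b"]) auto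

text \<open>Along the orbit \<open>g2 w \<ge> g2 c1 > 0\<close>, so the travel time is at most \<open>1 / g2 c1\<close> times the
  finite integral of \<open>1 / f2\<close>.\<close>

lemma blows_up_if_recip_integral_finite:
  assumes adm: "admissible f1" "admissible f2" "admissible g1" "admissible g2"
    and data: "0 < c1" "0 < c2" and fin: "recip_integral c2 f2 < \<infinity>"
  shows "blows_up (\<lambda>w z. f1 z * g1 w) (\<lambda>w z. f2 z * g2 w) c1 c2"
proof -
  interpret S: separable_system f1 f2 g1 g2 c1 c2
    using data adm[THEN admissible_pos] adm[THEN admissible_continuous]
    by unfold_locales (auto intro: continuous_on_subset)
  have f2: "continuous_on {c2..} f2" using S.cont(2) .
  have r: "continuous_on {c2..} (\<lambda>z. 1 / f2 z)"
    using S.f2_pos by (intro continuous_intros f2) (auto simp: less_imp_neq[THEN not_sym])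
  define \<Phi> where "\<Phi> = primitive c2 (\<lambda>z. 1 / f2 z)"
  obtain C where C: "\<And>z. c2 \<le> z \<Longrightarrow> \<Phi> z \<le> C"
    using recip_integral_finite_iff[OF f2 S.f2_pos] fin unfolding \<Phi>_def by auto
  have m: "0 < g2 c1" using S.g2_pos by simp
  have "S.time z \<le> C / g2 c1" if z: "z \<in> S.swept" for z
  proof -
    have z': "c2 \<le> z" "{c2..z} \<subseteq> S.swept" using half_open_from_subset[OF S.swept_half_open z] by auto
    have "\<Phi> c2 / g2 c1 - S.time c2 \<le> \<Phi> z / g2 c1 - S.time z"
    proof (rule DERIV_nonneg_imp_increasing_open[OF z'(1)])
      fix x assume "c2 < x" "x < z"
      then have x: "c2 < x" "x \<in> S.swept" using z' by auto
      have "g2 c1 \<le> g2 (S.orbit x)"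
        using S.orbit_ge[OF x(2)] data by (intro mono_onD[OF admissible_mono[OF adm(4)]]) auto
      then have "f2 x * g2 c1 \<le> S.speed x"
        using S.f2_pos[of x] x by (simp add: S.speed_def)
      then have "1 / S.speed x \<le> 1 / f2 x / g2 c1"
        using S.f2_pos[of x] x m by (simp add: frac_le)
      moreover have "((\<lambda>z. \<Phi> z / g2 c1 - S.time z) has_real_derivative 1 / f2 x / g2 c1 - 1 / S.speed x) (at x)"
        using primitive_has_derivative[OF half_open_from_atLeast r, of x] S.time_derivative[OF x(2,1)] x
        by (intro DERIV_diff DERIV_cdivide) (auto simp: \<Phi>_def)
      ultimately show "\<exists>y. ((\<lambda>z. \<Phi> z / g2 c1 - S.time z) has_real_derivative y) (at x) \<and> 0 \<le> y"
        by (intro exI conjI) auto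
    next
      have "continuous_on {c2..z} \<Phi>"
        unfolding \<Phi>_def by (rule continuous_on_subset[OF primitive_continuous[OF half_open_from_atLeast r]]) auto
      then show "continuous_on {c2..z} (\<lambda>z. \<Phi> z / g2 c1 - S.time z)"
        using m by (intro continuous_intros continuous_on_subset[OF S.time_continuous z'(2)]) auto
    qed
    then have "S.time z \<le> \<Phi> z / g2 c1" by (simp add: \<Phi>_def S.time_base)
    also have "\<dots> \<le> C / g2 c1" using C[OF z'(1)] m by (simp add: divide_right_mono)
    finally show ?thesis .
  qed
  from S.blowing_up_strict_solution[OF this] show ?thesis
    unfolding blows_up_def strictly_solves_on_def by blast
qed

theorem theoremA:
  fixes f1 f2 g1 g2 :: "real \<Rightarrow> real"
  assumes "admissible f1" and "admissible f2" and "admissible g1" and "admissible g2"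
  shows
    "(\<forall>c1 c2. 0 < c1 \<and> 0 < c2 \<and>
        (recip_integral c1 g1 < \<infinity> \<or> recip_integral c2 f2 < \<infinity>) \<longrightarrow>
        blows_up (\<lambda>w z. f1 z * g1 w) (\<lambda>w z. f2 z * g2 w) c1 c2) \<and>
     (\<exists>M>0. \<forall>c1 c2 w0 z0 ct3 ct4 \<epsilon> K.
        let G1 = primitive c1 (\<lambda>s. 1 / g1 s);
            F2 = primitive c2 (\<lambda>\<theta>. 1 / f2 \<theta>);
            ft = (\<lambda>Z. f1 (inv_into {c2..} F2 Z));
            gt = (\<lambda>W. g2 (inv_into {c1..} G1 W));
            ct1 = G1 w0;
            ct2 = F2 z0;
            Ft = primitive ct4 ft;
            Gt = primitive ct3 gt;
            Ft_inv = inv_into {ct4..} Ft;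
            Gt_inv = inv_into {ct3..} Gt
        in
          0 \<le> c1 \<and> 0 \<le> c2 \<and>
          recip_primitive_exists c1 g1 \<and> recip_primitive_exists c2 f2 \<and>
          recip_integral c1 g1 = \<infinity> \<and> recip_integral c2 f2 = \<infinity> \<and>
          c1 \<le> w0 \<and> c2 \<le> z0 \<and>
          0 \<le> ct3 \<and> ct3 \<le> ct1 \<and> 0 \<le> ct4 \<and> ct4 \<le> ct2 \<and>
          (\<forall>Z\<ge>ct4. 0 \<le> ft Z \<and> 0 \<le> vector_derivative ft (at Z within {ct4..})) \<and>
          (\<forall>W\<ge>ct3. 0 \<le> gt W \<and> 0 \<le> vector_derivative gt (at W within {ct3..})) \<and>
          0 < \<epsilon> \<and> 0 < K \<and>
          \<epsilon> * Gt ct1 \<le> Ft ct2 \<and> Ft ct2 \<le> K * Gt ct1 \<longrightarrow>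
          (recip_integral ct1 (\<lambda>s. ft (Ft_inv (K * Gt s))) = \<infinity> \<and>
           recip_integral ct2 (\<lambda>\<theta>. gt (Gt_inv (1 / \<epsilon> * Ft \<theta>))) = \<infinity> \<longrightarrow>
             exists_globally (\<lambda>W Z. ft Z) (\<lambda>W Z. gt W) ct1 ct2 \<and>
             exists_globally (\<lambda>w z. f1 z * g1 w) (\<lambda>w z. f2 z * g2 w) w0 z0) \<and>
          ((recip_integral ct1 (\<lambda>s. ft (Ft_inv (\<epsilon> * Gt s))) < \<infinity> \<or>
            recip_integral ct2 (\<lambda>\<theta>. gt (Gt_inv (1 / K * Ft \<theta>))) < \<infinity>) \<and>
           (M \<le> w0 \<and> M \<le> z0 \<or> M \<le> ct1 \<and> M \<le> ct2) \<longrightarrow>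
             blows_up (\<lambda>W Z. ft Z) (\<lambda>W Z. gt W) ct1 ct2 \<and>
             blows_up (\<lambda>w z. f1 z * g1 w) (\<lambda>w z. f2 z * g2 w) w0 z0))"
proof (intro conjI allI impI, goal_cases)
  case (1 c1 c2)
  then consider "recip_integral c1 g1 < \<infinity>" | "recip_integral c2 f2 < \<infinity>" by blast
  then show ?case
  proof cases
    case 1
    have "blows_up (\<lambda>z w. g2 w * f2 z) (\<lambda>z w. g1 w * f1 z) c2 c1"
      using blows_up_if_recip_integral_finite[OF assms(4,3,2,1)] 1 \<open>0 < c1 \<and> 0 < c2 \<and> _\<close> by blast
    then show ?thesis
      by (subst blows_up_swap) (simp add: mult.commute)
  next
    case 2
    then show ?thesis
      using blows_up_if_recip_integral_finite[OF assms] \<open>0 < c1 \<and> 0 < c2 \<and> _\<close> by blast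
  qed
next
  case 2
  \<comment> \<open>Data bounded below by a positive \<open>M\<close> stay off the axes, where both initial speeds are positive.\<close>
  show ?case
  proof (rule exI[of _ 1], intro conjI zero_less_one allI, unfold Let_def, intro impI, elim conjE, goal_cases)
    case (1 c1 c2 w0 z0 q p \<epsilon> K)
    interpret T: transformed_system c1 g1 c2 f2 f1 g2 w0 z0
      using admissible_reciprocal_coordinate[OF assms(3)] admissible_reciprocal_coordinate[OF assms(2)] 1
      by (simp add: transformed_system_def transformed_system_axioms_def)
    interpret T': transformed_system c2 f2 c1 g1 g2 f1 z0 w0
      using T.W.reciprocal_coordinate_axioms T.Z.reciprocal_coordinate_axioms T.data
      by (simp add: transformed_system_def transformed_system_axioms_def)
    define f where "f = (\<lambda>z. f1 (T.Z.uncoord z))"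
    define g where "g = (\<lambda>w. g2 (T.W.uncoord w))"
    define F where "F = primitive p f"
    define G where "G = primitive q g"
    let ?a = "T.W.coord w0" and ?b = "T.Z.coord z0"
    note hyps = 1[folded f_def g_def, folded F_def G_def]
    have pq: "0 \<le> p" "p \<le> ?b" "0 \<le> q" "q \<le> ?a" and K: "0 < \<epsilon>" "0 < K"
      and lo: "\<epsilon> * G ?a \<le> F ?b" and up: "F ?b \<le> K * G ?a"
      using hyps by auto
    have nonneg: "0 \<le> w0" "0 \<le> z0" "0 \<le> ?a" "0 \<le> ?b"
      using T.data 1 T.W.coord_nonneg T.Z.coord_nonneg by auto
    have "0 \<le> F ?b" "0 \<le> G ?a"
      unfolding F_def G_def f_def g_def
      using T.Z.admissible_uncoord[OF assms(1)] T.W.admissible_uncoord[OF assms(4)] pq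
      by (auto intro!: primitive_nonneg intro: continuous_on_subset)
    \<comment> \<open>Each of the two energies vanishes only together with the other one.\<close>
    then have corner: "F ?b \<noteq> 0 \<or> G ?a = 0" "G ?a \<noteq> 0 \<or> F ?b = 0"
      using lo up K mult_pos_pos[of \<epsilon> "G ?a"] by fastforce+
    note defs = f_def g_def F_def G_def
    have z_global: "exists_globally (\<lambda>w z. f z) (\<lambda>w z. g w) ?a ?b \<and>
        exists_globally (\<lambda>w z. f1 z * g1 w) (\<lambda>w z. f2 z * g2 w) w0 z0"
      if "0 < g2 w0" "0 < \<kappa>" "recip_integral ?b (\<lambda>\<theta>. g (inv_into {q..} G (\<kappa> * F \<theta>))) = \<infinity>" for \<kappa>
      using T.test_integral_decides(1)[OF assms(1,4) pq that(1) corner(1)[unfolded defs] that(2) that(3)[unfolded defs]]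
      by (simp add: f_def g_def)
    have w_global: "exists_globally (\<lambda>w z. f z) (\<lambda>w z. g w) ?a ?b \<and>
        exists_globally (\<lambda>w z. f1 z * g1 w) (\<lambda>w z. f2 z * g2 w) w0 z0"
      if "0 < f1 z0" "0 < \<kappa>" "recip_integral ?a (\<lambda>s. f (inv_into {p..} F (\<kappa> * G s))) = \<infinity>" for \<kappa>
      using T'.test_integral_decides(1)[OF assms(4,1) pq(3,4,1,2) that(1) corner(2)[unfolded defs] that(2)
          that(3)[unfolded defs]]
        exists_globally_swap[of "\<lambda>w z. f z" "\<lambda>w z. g w" ?a ?b]
        exists_globally_swap[of "\<lambda>w z. f1 z * g1 w" "\<lambda>w z. f2 z * g2 w" w0 z0]
      by (simp add: f_def g_def mult.commute)
    have z_blow_up: "blows_up (\<lambda>w z. f z) (\<lambda>w z. g w) ?a ?b \<and>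
        blows_up (\<lambda>w z. f1 z * g1 w) (\<lambda>w z. f2 z * g2 w) w0 z0"
      if "0 < g2 w0" "0 < \<kappa>" "recip_integral ?b (\<lambda>\<theta>. g (inv_into {q..} G (\<kappa> * F \<theta>))) < \<infinity>" for \<kappa>
      using T.test_integral_decides(2)[OF assms(1,4) pq that(1) corner(1)[unfolded defs] that(2) that(3)[unfolded defs]]
      by (simp add: f_def g_def)
    have w_blow_up: "blows_up (\<lambda>w z. f z) (\<lambda>w z. g w) ?a ?b \<and>
        blows_up (\<lambda>w z. f1 z * g1 w) (\<lambda>w z. f2 z * g2 w) w0 z0"
      if "0 < f1 z0" "0 < \<kappa>" "recip_integral ?a (\<lambda>s. f (inv_into {p..} F (\<kappa> * G s))) < \<infinity>" for \<kappa>
      using T'.test_integral_decides(2)[OF assms(4,1) pq(3,4,1,2) that(1) corner(2)[unfolded defs] that(2)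
          that(3)[unfolded defs]]
        blows_up_swap[of "\<lambda>w z. f z" "\<lambda>w z. g w" ?a ?b]
        blows_up_swap[of "\<lambda>w z. f1 z * g1 w" "\<lambda>w z. f2 z * g2 w" w0 z0]
      by (simp add: f_def g_def mult.commute)
    have global: "exists_globally (\<lambda>w z. f z) (\<lambda>w z. g w) ?a ?b \<and>
        exists_globally (\<lambda>w z. f1 z * g1 w) (\<lambda>w z. f2 z * g2 w) w0 z0"
      if inf: "recip_integral ?a (\<lambda>s. f (inv_into {p..} F (K * G s))) = \<infinity> \<and>
        recip_integral ?b (\<lambda>\<theta>. g (inv_into {q..} G (1 / \<epsilon> * F \<theta>))) = \<infinity>"
    proof -
      \<comment> \<open>The variable with positive initial speed is the parameter; without one, the data are an equilibrium.\<close>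
      consider "0 < g2 w0" | "0 < f1 z0" | "g2 w0 = 0" "f1 z0 = 0"
        using admissible_nonneg[OF assms(1) nonneg(2)] admissible_nonneg[OF assms(4) nonneg(1)]
        by fastforce
      then show ?thesis
      proof cases
        case 1
        then show ?thesis using z_global[of "1 / \<epsilon>"] K inf by simp
      next
        case 2
        then show ?thesis using w_global K inf by blast
      next
        case 3
        then have "g ?a = 0" "f ?b = 0"
          using T.data by (simp_all add: f_def g_def T.Z.uncoord_coord T.W.uncoord_coord)
        then show ?thesis
          using 3 nonneg by (auto intro!: exists_globally_equilibrium)
      qed
    qed
    have blow_up: "blows_up (\<lambda>w z. f z) (\<lambda>w z. g w) ?a ?b \<and>
        blows_up (\<lambda>w z. f1 z * g1 w) (\<lambda>w z. f2 z * g2 w) w0 z0"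
      if fin: "(recip_integral ?a (\<lambda>s. f (inv_into {p..} F (\<epsilon> * G s))) < \<infinity> \<or>
          recip_integral ?b (\<lambda>\<theta>. g (inv_into {q..} G (1 / K * F \<theta>))) < \<infinity>) \<and>
        (1 \<le> w0 \<and> 1 \<le> z0 \<or> 1 \<le> ?a \<and> 1 \<le> ?b)"
    proof -
      have "0 < w0" "0 < z0"
        using fin nonneg T.data T.W.base_nonneg T.Z.base_nonneg primitive_at_base
        by (smt (verit))+
      then have start: "0 < f1 z0" "0 < g2 w0"
        using admissible_pos assms by blast+
      then show ?thesis
        using fin K w_blow_up[of \<epsilon>] z_blow_up[of "1 / K"] by auto
    qed
    from global blow_up show ?case
      unfolding defs by blast
  qed
qed

end
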